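(* Let $q$ be a power of an odd prime and let $v_{Sp,2n}$ be the average, over a uniformly random element of $Sp(2n,q)$, of the order of the element. For fixed $q$ and growing $n$, $$\log(v_{Sp,2n})\ \geq\ n\log(q)-\log(n)+o(\log(n)).$$
   Context: $Sp(2n,q)$ is the subgroup of $GL(2n,q)$ preserving a non-degenerate alternating form on $F_q^{2n}$. The order of an element is its order as a group element. *)

theory Defs
  imports
    Complex_Main
    "HOL-Library.Landau_Symbols"
    "HOL-Algebra.Multiplicative_Group"
    "Jordan_Normal_Form.Matrix"
begin

section \<open>Forms on the column space of dimension \<open>m\<close>\<close>

text \<open>Forms are functions on all vectors, so every condition is relativised to
  \<^term>\<open>carrier_vec m\<close>; values elsewhere are irrelevant.\<close>

definition bilinear_form :: "nat \<Rightarrow> ('a::field vec \<Rightarrow> 'a vec \<Rightarrow> 'a) \<Rightarrow> bool" where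
  "bilinear_form m B \<longleftrightarrow>
     (\<forall>x\<in>carrier_vec m. \<forall>y\<in>carrier_vec m. \<forall>z\<in>carrier_vec m. \<forall>c.
        B (x + y) z = B x z + B y z \<and>
        B x (y + z) = B x y + B x z \<and>
        B (c \<cdot>\<^sub>v x) y = c * B x y \<and>
        B x (c \<cdot>\<^sub>v y) = c * B x y)"

definition alternating_form :: "nat \<Rightarrow> ('a::field vec \<Rightarrow> 'a vec \<Rightarrow> 'a) \<Rightarrow> bool" where
  "alternating_form m B \<longleftrightarrow> bilinear_form m B \<and> (\<forall>x\<in>carrier_vec m. B x x = 0)"

definition nondegenerate_form :: "nat \<Rightarrow> ('a::field vec \<Rightarrow> 'a vec \<Rightarrow> 'a) \<Rightarrow> bool" where
  "nondegenerate_form m B \<longleftrightarrow>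
     (\<forall>x\<in>carrier_vec m. (\<forall>y\<in>carrier_vec m. B x y = 0) \<longrightarrow> x = 0\<^sub>v m)"


section \<open>The general linear group and the symplectic group of a form\<close>

definition GL :: "nat \<Rightarrow> 'a::field mat monoid" where
  "GL m = units_of (ring_mat TYPE('a) m ())"

text \<open>This is the isometry group of \<open>B\<close>; it is a symplectic group when \<open>B\<close> is a non-degenerate
  alternating form (and then \<open>m\<close> is even).\<close>

definition Sp :: "nat \<Rightarrow> ('a::field vec \<Rightarrow> 'a vec \<Rightarrow> 'a) \<Rightarrow> 'a mat monoid" where
  "Sp m B = (GL m)\<lparr>carrier :=
     {A \<in> carrier (GL m). \<forall>x\<in>carrier_vec m. \<forall>y\<in>carrier_vec m. B (A *\<^sub>v x) (A *\<^sub>v y) = B x y}\<rparr>"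

lemma carrier_GL:
  "A \<in> carrier (GL m) \<longleftrightarrow>
     A \<in> carrier_mat m m \<and> (\<exists>C\<in>carrier_mat m m. C * A = 1\<^sub>m m \<and> A * C = 1\<^sub>m m)"
  by (auto simp: GL_def units_of_def Units_def ring_mat_def)

lemma mult_GL [simp]: "A \<otimes>\<^bsub>GL m\<^esub> C = A * C"
  by (simp add: GL_def units_of_def ring_mat_def)

lemma one_GL [simp]: "\<one>\<^bsub>GL m\<^esub> = 1\<^sub>m m"
  by (simp add: GL_def units_of_def ring_mat_def)

lemma group_GL: "group (GL m :: 'a::field mat monoid)"
proof -
  interpret semiring "ring_mat TYPE('a) m ()" by (rule semiring_mat)
  show ?thesis unfolding GL_def by (rule units_group)
qed

lemma subgroup_Sp: "subgroup (carrier (Sp m B)) (GL m)"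
proof -
  interpret group "GL m :: 'a mat monoid" by (rule group_GL)
  show ?thesis
  proof (rule subgroupI)
    show "carrier (Sp m B) \<subseteq> carrier (GL m)"
      by (auto simp: Sp_def)
    have "\<one>\<^bsub>GL m\<^esub> \<in> carrier (Sp m B)"
      using one_closed by (simp add: Sp_def)
    then show "carrier (Sp m B) \<noteq> {}" by blast
  next
    fix A assume A: "A \<in> carrier (Sp m B)"
    then have AG: "A \<in> carrier (GL m)" by (simp add: Sp_def)
    define C where "C = inv\<^bsub>GL m\<^esub> A"
    have CG: "C \<in> carrier (GL m)" using AG by (simp add: C_def)
    have AC: "A * C = 1\<^sub>m m" using r_inv[OF AG] by (simp add: C_def)
    have cA: "A \<in> carrier_mat m m" and cC: "C \<in> carrier_mat m m"
      using AG CG by (auto simp: carrier_GL)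
    have "B (C *\<^sub>v x) (C *\<^sub>v y) = B x y"
      if x: "x \<in> carrier_vec m" and y: "y \<in> carrier_vec m" for x y
    proof -
      have "A *\<^sub>v (C *\<^sub>v z) = z" if "z \<in> carrier_vec m" for z
        using assoc_mult_mat_vec[OF cA cC that] AC that by simp
      moreover have "B (A *\<^sub>v (C *\<^sub>v x)) (A *\<^sub>v (C *\<^sub>v y)) = B (C *\<^sub>v x) (C *\<^sub>v y)"
        using A x y cC by (auto simp: Sp_def)
      ultimately show ?thesis using x y by simp
    qed
    then show "inv\<^bsub>GL m\<^esub> A \<in> carrier (Sp m B)"
      using CG by (simp add: Sp_def C_def)
  next
    fix A C assume A: "A \<in> carrier (Sp m B)" and C: "C \<in> carrier (Sp m B)"
    then have AG: "A \<in> carrier (GL m)" and CG: "C \<in> carrier (GL m)" by (simp_all add: Sp_def)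
    have cA: "A \<in> carrier_mat m m" and cC: "C \<in> carrier_mat m m"
      using AG CG by (auto simp: carrier_GL)
    have "B ((A * C) *\<^sub>v x) ((A * C) *\<^sub>v y) = B x y"
      if x: "x \<in> carrier_vec m" and y: "y \<in> carrier_vec m" for x y
      using A C x y cC assoc_mult_mat_vec[OF cA cC x] assoc_mult_mat_vec[OF cA cC y]
      by (simp add: Sp_def)
    then show "A \<otimes>\<^bsub>GL m\<^esub> C \<in> carrier (Sp m B)"
      using m_closed[OF AG CG] by (simp add: Sp_def)
  qed
qed

lemma group_Sp: "group (Sp m B)"
proof -
  have "Sp m B = (GL m)\<lparr>carrier := carrier (Sp m B)\<rparr>" by (simp add: Sp_def)
  then show ?thesis
    using subgroup.subgroup_is_group[OF subgroup_Sp group_GL, of m B] by simp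
qed


section \<open>The average order of a uniformly random element of a finite group\<close>

definition avg_order :: "('g, 'b) monoid_scheme \<Rightarrow> real" where
  "avg_order G = (\<Sum>g\<in>carrier G. real (group.ord G g)) / real (card (carrier G))"

end

theory Submission
  imports "HOL-Algebra.Algebraic_Closure_Type" "HOL-Number_Theory.Number_Theory"
    "HOL-Real_Asymp.Real_Asymp" Defs
begin

text \<open>Put \<open>N = q ^ n + 1\<close>. Any non-degenerate alternating form on \<open>F_q ^ (2n)\<close> is isometric to
  the form \<open>Tr (c x y ^ (q ^ n))\<close> on the field \<open>K\<close> with \<open>q ^ (2n)\<close> elements, where
  \<open>c ^ (q ^ n) = - c\<close>. Multiplication by a root of unity of order \<open>N\<close> preserves this form and
  generates a cyclic group whose normaliser in \<open>Sp(2n, q)\<close> has at most \<open>2 n N\<close> elements (the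
  Galois conjugates of the root of unity times the elements of norm 1). Counting the conjugates of
  its generators, at least a fraction \<open>\<phi>(N) / (2 n N)\<close> of \<open>Sp(2n, q)\<close> has order \<open>N\<close>,
  so the average order is at least \<open>\<phi>(N) / (2 n)\<close>. Finally \<open>\<phi>(N) / N\<close> is at least
  a negative power of \<open>ln n\<close>, because \<open>N\<close> has only \<open>O(n)\<close> prime factors and the
  reciprocals of the primes up to \<open>x\<close> sum to \<open>O(ln (ln x))\<close>.\<close>

section \<open>A lower bound for the totient function\<close>

text \<open>The conjugates of a single generator of the cyclic group would add only a bounded amount
  to the average. Counting all \<open>totient N\<close> generators is what makes the average large,
  and it is paid for by passing from the centraliser to the normaliser, a factor
  \<open>2 * n\<close>: this is the origin of \<open>- ln n\<close> and of the constant
  \<open>ln 2\<close>. No Galois theory is needed for the normaliser. Read on K, an element of it is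
  linear over the base field and turns multiplication by the root of unity \<open>w\<close> into
  multiplication by some \<open>z\<close>; a polynomial of degree \<open>2 * n\<close> limits
  \<open>z\<close>, and non-degeneracy of the form limits the image of 1. The degree
  \<open>2 * n\<close> varies while the base field is a type, so K is a finite subset of an
  algebraic closure. Vector spaces are therefore sets with a form constrained on the set, and
  dimension arguments become counting arguments. The error term absorbs any fixed power of
  \<open>ln n\<close>, so crude constants suffice in the totient bound.\<close>

lemma prod_primes_dvd:
  fixes n :: nat
  assumes "finite P" "\<And>p. p \<in> P \<Longrightarrow> prime p \<and> p dvd n"
  shows "\<Prod>P dvd n"
  using assms
proof (induction P rule: finite_induct)
  case (insert p P)
  then have "coprime p (\<Prod>P)"
    by (intro prod_coprime_right) (metis insertCI primes_coprime)
  then show ?case using insert by (simp add: divides_mult)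
qed simp

text \<open>Chebyshev's argument: a prime in \<open>(m, 2m]\<close> divides the central binomial
  coefficient, which is at most \<open>4^m\<close>. For \<open>m = 2^i\<close> this leaves at most
  \<open>2m/i\<close> such primes, each with reciprocal below \<open>1/m\<close>.\<close>

lemma sum_inverse_primes_dyadic_block:
  assumes "i \<ge> 1"
  shows "(\<Sum>p | prime p \<and> p \<in> {2^i<..2^Suc i}. 1 / real p) \<le> 2 / real i"
proof -
  define m :: nat where "m = 2^i"
  define P where "P = {p. prime p \<and> p \<in> {m<..2*m}}"
  have finP: "finite P" by (rule finite_subset[of _ "{..2*m}"]) (auto simp: P_def)
  have fact_eq: "fact m * fact m * (2*m choose m) = fact (2*m)"
    using binomial_fact_lemma[of m "2*m"] by simp
  have "p dvd (2*m choose m)" if "p \<in> P" for p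
  proof -
    have p: "prime p" "m < p" "p \<le> 2*m" using that by (auto simp: P_def)
    have "p dvd fact m * fact m * (2*m choose m)"
      unfolding fact_eq using p by (simp add: prime_dvd_fact_iff)
    then show ?thesis using p by (auto simp: prime_dvd_mult_iff prime_dvd_fact_iff)
  qed
  then have "\<Prod>P dvd (2*m choose m)"
    by (intro prod_primes_dvd finP) (auto simp: P_def)
  then have "\<Prod>P \<le> (2*m choose m)"
    by (rule dvd_imp_le) simp
  also have "\<dots> \<le> 2^(2*m)" by (rule binomial_le_pow2)
  finally have "\<Prod>P \<le> 2^(2*m)" .
  moreover have "m ^ card P \<le> \<Prod>P"
    using prod_mono[of P "\<lambda>_. m" "\<lambda>p. p"] by (auto simp: P_def)
  ultimately have "(2::nat) ^ (i * card P) \<le> 2^(2*m)"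
    by (simp add: m_def power_mult)
  then have c: "i * card P \<le> 2 * m" by simp
  have "(\<Sum>p\<in>P. 1 / real p) \<le> (\<Sum>p\<in>P. 1 / real m)"
    by (rule sum_mono) (auto simp: P_def m_def intro!: divide_left_mono)
  also have "\<dots> = real (card P) / real m" by simp
  also have "\<dots> \<le> 2 / real i"
  proof -
    have "real i * real (card P) \<le> 2 * real m"
      using of_nat_mono[where 'a=real, OF c] by simp
    then show ?thesis using assms by (simp add: field_simps m_def)
  qed
  finally show ?thesis by (simp add: P_def m_def)
qed

text \<open>The block bounds \<open>2/i\<close> add up to a harmonic sum, hence to
  \<open>O(ln (ln x))\<close> for \<open>x = 2^K\<close>. The \<open>1/2\<close> is the prime
  2.\<close>

lemma sum_inverse_primes_le_ln:
  assumes "K \<ge> 1"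
  shows "(\<Sum>p | prime p \<and> p \<le> 2^K. 1 / real p) \<le> 1 / 2 + 4 * ln (real K)"
  using assms
proof (induction K rule: dec_induct)
  case base
  have "{p::nat. prime p \<and> p \<le> 2^1} = {2}"
    using prime_ge_2_nat two_is_prime_nat by (auto intro: antisym)
  then show ?case by simp
next
  case (step K)
  have "{p::nat. prime p \<and> p \<le> 2^Suc K}
      = {p. prime p \<and> p \<le> 2^K} \<union> {p. prime p \<and> p \<in> {2^K<..2^Suc K}}"
    by auto
  moreover have "finite {p::nat. prime p \<and> p \<le> 2^K}" "finite {p::nat. prime p \<and> p \<in> {2^K<..2^Suc K}}"
    by (auto intro: finite_subset[of _ "{..2^Suc K}"] finite_subset[of _ "{..2^K}"])
  ultimately have "(\<Sum>p | prime p \<and> p \<le> 2^Suc K. 1 / real p)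
      = (\<Sum>p | prime p \<and> p \<le> 2^K. 1 / real p)
        + (\<Sum>p | prime p \<and> p \<in> {2^K<..2^Suc K}. 1 / real p)"
    by (simp only:) (rule sum.union_disjoint, auto)
  also have "\<dots> \<le> 1 / 2 + 4 * ln (real K) + 2 / real K"
    using step sum_inverse_primes_dyadic_block[of K] by linarith
  \<comment> \<open>The constant 4 comes from \<open>1/(K+1) \<le> ln (K+1) - ln K\<close> together
    with \<open>K + 1 \<le> 2 K\<close>.\<close>
  also have "2 / real K \<le> 4 * (ln (real (Suc K)) - ln (real K))"
  proof -
    have K: "real K \<ge> 1" using step by simp
    have "ln (real K / real (Suc K)) \<le> real K / real (Suc K) - 1"
      using K by (intro ln_le_minus_one) auto
    then have "1 / real (Suc K) \<le> ln (real (Suc K)) - ln (real K)"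
      using K by (simp add: ln_div field_simps)
    moreover have "1 / (2 * real K) \<le> 1 / real (Suc K)"
      using K by (intro divide_left_mono) auto
    ultimately show ?thesis by simp
  qed
  finally show ?case by simp
qed

text \<open>\<open>N\<close> has at most \<open>w\<close> prime factors, so those above
  \<open>2^K\<close> add at most \<open>w / 2^K \<le> 1\<close> to the sum of \<open>1/p\<close>;
  the others are covered by the sum over all primes up to \<open>2^K\<close>. The total
  \<open>3/2 + 4 ln K\<close> is doubled by \<open>ln (1 - x) \<ge> - 2 x\<close> for
  \<open>x \<le> 1/2\<close>, whence 3 and 8.\<close>

lemma ln_totient_ge:
  assumes "N \<ge> 1" "N \<le> 2^w" "w \<le> 2^K" "K \<ge> 1"
  shows "ln (real (totient N)) \<ge> ln (real N) - 3 - 8 * ln (real K)"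
proof -
  let ?P = "prime_factors N"
  let ?S = "{p::nat. prime p \<and> p \<le> 2^K}"
  have finS: "finite ?S" by (auto intro: finite_subset[of _ "{..2^K}"])
  have "(2::nat) ^ card ?P \<le> \<Prod>?P"
    using prod_mono[of ?P "\<lambda>_. 2::nat" "\<lambda>p. p"] prime_ge_2_nat by auto
  also have "\<Prod>?P \<le> N"
    by (intro dvd_imp_le prod_primes_dvd) (use assms in auto)
  also have "\<dots> \<le> 2^w" by fact
  finally have cP: "card ?P \<le> w" by simp
  have "(\<Sum>p\<in>?P. 1 / real p) = (\<Sum>p\<in>?P \<inter> ?S. 1 / real p) + (\<Sum>p\<in>?P - ?S. 1 / real p)"
    by (rule sum.Int_Diff) simp
  also have "(\<Sum>p\<in>?P \<inter> ?S. 1 / real p) \<le> (\<Sum>p\<in>?S. 1 / real p)"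
    by (rule sum_mono2) (use finS in auto)
  also have "\<dots> \<le> 1 / 2 + 4 * ln (real K)"
    using sum_inverse_primes_le_ln assms by simp
  also have "(\<Sum>p\<in>?P - ?S. 1 / real p) \<le> (\<Sum>p\<in>?P - ?S. 1 / 2^K)"
    by (rule sum_mono) (auto intro!: divide_left_mono simp: not_le intro: less_imp_le)
  also have "\<dots> \<le> real w / 2^K"
    using cP card_mono[of ?P "?P - ?S"] by (simp add: divide_right_mono)
  also have "\<dots> \<le> 1" using of_nat_mono[where 'a=real, OF assms(3)] by simp
  finally have S: "(\<Sum>p\<in>?P. 1 / real p) \<le> 3 / 2 + 4 * ln (real K)" by simp
  have p2: "p \<ge> 2" if "p \<in> ?P" for p using that prime_ge_2_nat by auto
  have "- 2 * (\<Sum>p\<in>?P. 1 / real p) = (\<Sum>p\<in>?P. - 2 * (1 / real p))"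
    by (rule sum_distrib_left)
  also have "\<dots> \<le> (\<Sum>p\<in>?P. ln (1 - 1 / real p))"
  proof (rule sum_mono)
    fix p assume "p \<in> ?P"
    then have p: "real p \<ge> 2" using p2 by fastforce
    then have "- (1 / real p) - 2 * (1 / real p)^2 \<le> ln (1 - 1 / real p)"
      by (intro ln_one_minus_pos_lower_bound) (auto simp: field_simps)
    moreover have "2 * (1 / real p)^2 \<le> 1 / real p"
      using p by (simp add: power2_eq_square field_simps)
    ultimately show "- 2 * (1 / real p) \<le> ln (1 - 1 / real p)" by simp
  qed
  also have "\<dots> = ln (\<Prod>p\<in>?P. 1 - 1 / real p)"
    by (rule ln_prod[symmetric]) (use p2 in fastforce)+
  finally have L: "ln (\<Prod>p\<in>?P. 1 - 1 / real p) \<ge> - 3 - 8 * ln (real K)"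
    using S by simp
  have pos: "(\<Prod>p\<in>?P. 1 - 1 / real p) > 0"
    by (rule prod_pos) (use p2 in fastforce)
  have "ln (real (totient N)) = ln (real N) + ln (\<Prod>p\<in>?P. 1 - 1 / real p)"
    unfolding totient_formula2 by (rule ln_mult_pos) (use assms(1) pos in \<open>simp_all only: of_nat_0_less_iff\<close>)
  then show ?thesis using L by simp
qed

text \<open>This sequence is the error term of the theorem; \<open>ln 2\<close> accounts for the
  factor 2 in \<open>2 * n\<close>. Taking \<open>K\<close> of size about \<open>log 2 n\<close>
  makes the loss \<open>O(ln (ln n))\<close>.\<close>

lemma ln_totient_power_Suc_asymp:
  fixes q :: nat
  assumes "q \<ge> 2"
  shows "(\<lambda>n. ln (real (totient (q^n + 1))) - real n * ln (real q) - ln 2) \<in> o(\<lambda>n. ln (real n))"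
proof -
  define l where "l n = 1 + log 2 (real q * real n + 1)" for n :: nat
  have q: "real q > 0" using assms by simp
  have up: "ln (real (totient (q^n + 1))) \<le> real n * ln (real q)" for n
  proof -
    have "totient (q^n + 1) \<le> q^n"
      using totient_less[of "q^n + 1"] assms by simp
    then have "ln (real (totient (q^n + 1))) \<le> ln (real (q^n))"
      using of_nat_mono[where 'a=real] by (subst ln_le_cancel_iff) (use assms in auto)
    then show ?thesis using q by (simp add: ln_realpow)
  qed
  have lo: "ln (real (totient (q^n + 1))) \<ge> real n * ln (real q) - 3 - 8 * ln (l n)" if "n \<ge> 1" for n
  proof -
    \<comment> \<open>The crude \<open>q \<le> 2^q\<close> makes \<open>w\<close> linear in
      \<open>n\<close>, which is enough because only \<open>ln (log 2 w)\<close> matters.\<close>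
    define w where "w = q * n + 1"
    define K where "K = nat \<lceil>log 2 (real w)\<rceil>"
    have w1: "real w > 1" using that assms by (simp add: w_def)
    then have lw: "log 2 (real w) > 0" by simp
    have K1: "K \<ge> 1" using lw by (simp add: K_def) linarith
    have "real w = 2 powr (log 2 (real w))" using w1 by simp
    also have "\<dots> \<le> 2 powr real K"
      by (intro powr_mono) (use lw in \<open>auto simp: K_def\<close>)
    finally have wK: "w \<le> 2^K"
      by (metis of_nat_le_iff of_nat_numeral of_nat_power powr_realpow zero_less_numeral)
    have "q^n + 1 \<le> (2^q)^n + (1::nat)"
      by (intro add_mono power_mono) (auto intro: less_imp_le)
    also have "\<dots> \<le> 2^w" by (simp add: w_def power_mult)
    finally have "q^n + 1 \<le> 2^w" .
    from ln_totient_ge[OF _ this wK K1]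
    have "ln (real (totient (q^n + 1))) \<ge> ln (real (q^n + 1)) - 3 - 8 * ln (real K)" by simp
    moreover have "ln (real (q^n + 1)) \<ge> ln (real (q^n))"
      using q by (subst ln_le_cancel_iff) (auto intro: add_pos_pos)
    moreover have "ln (real K) \<le> ln (l n)"
    proof -
      have "real K \<le> l n" using lw by (simp add: K_def l_def w_def add.commute) linarith
      then show ?thesis using K1 by simp
    qed
    ultimately show ?thesis using q by (simp add: ln_realpow)
  qed
  have "(\<lambda>n. ln (real (totient (q^n + 1))) - real n * ln (real q) - ln 2)
      \<in> O(\<lambda>n. 4 + 8 * ln (l n))"
  proof (rule bigoI[of _ 1], rule eventually_sequentiallyI[of 1])
    fix n :: nat assume n: "n \<ge> 1"
    \<comment> \<open>The 4 in the majorant is the 3 of the lower bound plus this bound for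
      \<open>ln 2\<close>.\<close>
    have "ln (2::real) \<le> 1" using ln_le_minus_one[of 2] by simp
    moreover have "ln (2::real) \<ge> 0" by simp
    moreover have "norm (t - u - c) \<le> 1 * norm (4 + 8 * z)"
      if "c \<le> 1" "c \<ge> 0" "t \<le> u" "t \<ge> u - 3 - 8 * z" for t u c z :: real
      using that by (auto simp: abs_if)
    ultimately show "norm (ln (real (totient (q^n + 1))) - real n * ln (real q) - ln 2)
        \<le> 1 * norm (4 + 8 * ln (l n))"
      using up[of n] lo[OF n] by blast
  qed
  also have "(\<lambda>n. 4 + 8 * ln (l n)) \<in> o(\<lambda>n. ln (real n))"
    unfolding l_def using q by real_asymp
  finally show ?thesis .
qed

section \<open>Darboux bases\<close>

text \<open>The vectors with indices \<open>2 i\<close> and \<open>2 i + 1\<close> of a Darboux basis form a hyperbolic pair;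
  \<open>swap_pair\<close> exchanges the two indices.\<close>

definition swap_pair :: "nat \<Rightarrow> nat" where
  "swap_pair i = (if even i then Suc i else i - 1)"

lemma swap_pair_swap_pair [simp]: "swap_pair (swap_pair i) = i"
  by (auto simp: swap_pair_def)

lemma swap_pair_less [simp]: "swap_pair i < 2 * k \<longleftrightarrow> i < 2 * k"
  unfolding swap_pair_def by presburger

lemma swap_pair_eq_iff: "i = swap_pair j \<longleftrightarrow> j = swap_pair i"
  by (metis swap_pair_swap_pair)

text \<open>The Gram matrix of an orthogonal sum of hyperbolic planes: the sign is 1 when the even
  index of the pair comes first.\<close>

definition darboux_form :: "nat \<Rightarrow> nat \<Rightarrow> 'f::field" where
  "darboux_form i j = (if j = swap_pair i then (-1) ^ i else 0)"

lemma darboux_form_mult_self [simp]: "(-1) ^ i * ((-1) ^ i :: 'f::field) = 1"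
  by (simp flip: power_add)

text \<open>The dimension is prescribed through the cardinality of \<open>V\<close>, so that
  spanning can be settled by counting. The form is constrained on \<open>V\<close> only, since
  \<open>V\<close> will be a finite subset of an algebraic closure.\<close>

locale symplectic_space = vector_space scale
  for scale :: "'f::{field,finite} \<Rightarrow> 'v::ab_group_add \<Rightarrow> 'v" (infixr "*s" 75) +
  fixes V :: "'v set" and B :: "'v \<Rightarrow> 'v \<Rightarrow> 'f" and n :: nat
  assumes subspace_V: "subspace V"
    and card_V: "card V = card (UNIV :: 'f set) ^ (2 * n)"
    and add_left: "\<And>x y z. x \<in> V \<Longrightarrow> y \<in> V \<Longrightarrow> z \<in> V \<Longrightarrow> B (x + y) z = B x z + B y z"
    and add_right: "\<And>x y z. x \<in> V \<Longrightarrow> y \<in> V \<Longrightarrow> z \<in> V \<Longrightarrow> B x (y + z) = B x y + B x z"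
    and scale_left': "\<And>c x y. x \<in> V \<Longrightarrow> y \<in> V \<Longrightarrow> B (c *s x) y = c * B x y"
    and scale_right': "\<And>c x y. x \<in> V \<Longrightarrow> y \<in> V \<Longrightarrow> B x (c *s y) = c * B x y"
    and alternating: "\<And>x. x \<in> V \<Longrightarrow> B x x = 0"
    and nondegenerate: "\<And>x. x \<in> V \<Longrightarrow> (\<And>y. y \<in> V \<Longrightarrow> B x y = 0) \<Longrightarrow> x = 0"
begin

lemma card_field_gt_1: "card (UNIV :: 'f set) > 1"
  using card_mono[of "UNIV :: 'f set" "{0, 1}"] by simp

lemma finite_V: "finite V"
  using card_V card_field_gt_1 by (intro card_ge_0_finite) simp

lemmas V_closed = subspace_0[OF subspace_V] subspace_add[OF subspace_V]
  subspace_diff[OF subspace_V] subspace_scale[OF subspace_V] subspace_sum[OF subspace_V]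

lemma skew: "x \<in> V \<Longrightarrow> y \<in> V \<Longrightarrow> B x y = - B y x"
  using alternating[of "x + y"] alternating[of x] alternating[of y]
  by (simp add: V_closed add_left add_right add_eq_0_iff)

lemma zero_left: "y \<in> V \<Longrightarrow> B 0 y = 0"
  using scale_left'[of 0 y 0] V_closed by simp

lemma zero_right: "y \<in> V \<Longrightarrow> B y 0 = 0"
  using scale_right'[of y 0 0] V_closed by simp

lemma diff_left: "x \<in> V \<Longrightarrow> y \<in> V \<Longrightarrow> z \<in> V \<Longrightarrow> B (x - y) z = B x z - B y z"
  using add_left[of "x - y" y z] by (simp add: V_closed)

lemma diff_right: "x \<in> V \<Longrightarrow> y \<in> V \<Longrightarrow> z \<in> V \<Longrightarrow> B x (y - z) = B x y - B x z"
  using add_right[of x "y - z" z] by (simp add: V_closed)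

lemma sum_left:
  assumes "finite A" "\<And>i. i \<in> A \<Longrightarrow> b i \<in> V" "y \<in> V"
  shows "B (\<Sum>i\<in>A. c i *s b i) y = (\<Sum>i\<in>A. c i * B (b i) y)"
  using assms
  by (induction A rule: finite_induct) (simp_all add: zero_left add_left V_closed scale_left')

lemma sum_right:
  assumes "finite A" "\<And>i. i \<in> A \<Longrightarrow> b i \<in> V" "y \<in> V"
  shows "B y (\<Sum>i\<in>A. c i *s b i) = (\<Sum>i\<in>A. c i * B y (b i))"
  using assms
  by (induction A rule: finite_induct) (simp_all add: zero_right add_right V_closed scale_right')

definition darboux_upto :: "nat \<Rightarrow> (nat \<Rightarrow> 'v) \<Rightarrow> bool" where
  "darboux_upto k b \<longleftrightarrow>
     (\<forall>i<2*k. b i \<in> V) \<and> (\<forall>i<2*k. \<forall>j<2*k. B (b i) (b j) = darboux_form i j)"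

text \<open>Pairing a combination of the \<open>b j\<close> with the partner of \<open>b j\<close>
  isolates the coefficient of \<open>b j\<close> up to the sign \<open>(-1)^j\<close>, which the
  first factor undoes.\<close>

definition darboux_coord :: "(nat \<Rightarrow> 'v) \<Rightarrow> 'v \<Rightarrow> nat \<Rightarrow> 'f" where
  "darboux_coord b v j = (-1) ^ j * B v (b (swap_pair j))"

lemma darboux_comb_pairing:
  assumes "darboux_upto k b" "i < 2 * k"
  shows "B (\<Sum>j<2*k. c j *s b j) (b i) = c (swap_pair i) * (-1) ^ swap_pair i"
proof -
  have "B (\<Sum>j<2*k. c j *s b j) (b i) = (\<Sum>j<2*k. c j * B (b j) (b i))"
    using assms by (intro sum_left) (auto simp: darboux_upto_def)
  also have "\<dots> = (\<Sum>j<2*k. if j = swap_pair i then c j * (-1) ^ j else 0)"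
    using assms by (intro sum.cong)
      (auto simp: darboux_upto_def darboux_form_def swap_pair_eq_iff[of i])
  also have "\<dots> = c (swap_pair i) * (-1) ^ swap_pair i"
    using assms by simp
  finally show ?thesis .
qed

text \<open>Subtracting the coordinate combination is orthogonal projection away from the hyperbolic
  pairs found so far: the symplectic version of Gram-Schmidt.\<close>

lemma darboux_residual_orthogonal:
  assumes "darboux_upto k b" "i < 2 * k" "v \<in> V"
  shows "B (v - (\<Sum>j<2*k. darboux_coord b v j *s b j)) (b i) = 0"
proof -
  have bV: "\<And>j. j < 2 * k \<Longrightarrow> b j \<in> V" using assms by (auto simp: darboux_upto_def)
  have "(\<Sum>j<2*k. darboux_coord b v j *s b j) \<in> V"
    by (intro V_closed) (use bV in auto)
  then show ?thesis
    using darboux_comb_pairing[OF assms(1,2), of "darboux_coord b v"] assms bV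
    by (simp add: diff_left darboux_coord_def mult.assoc mult.left_commute)
qed

text \<open>The first \<open>2 * k\<close> vectors have too few combinations to fill
  \<open>V\<close>. A vector outside them leaves a nonzero residual \<open>e\<close>; non-degeneracy
  gives \<open>e\<close> a partner, which is scaled and projected to become
  \<open>f\<close>.\<close>

lemma darboux_extend:
  assumes b: "darboux_upto k b" and k: "k < n"
  shows "\<exists>b'. darboux_upto (Suc k) b'"
proof -
  have bV: "\<And>j. j < 2 * k \<Longrightarrow> b j \<in> V" using b by (auto simp: darboux_upto_def)
  let ?comb = "\<lambda>c. \<Sum>j<2*k. c j *s b j"
  let ?C = "{..<2*k} \<rightarrow>\<^sub>E (UNIV :: 'f set)"
  have "card (?comb ` ?C) \<le> card ?C"
    by (intro card_image_le finite_PiE) auto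
  also have "\<dots> = card (UNIV :: 'f set) ^ (2 * k)" by (simp add: card_PiE)
  also have "\<dots> < card V"
    using k card_field_gt_1 by (simp add: card_V)
  finally have "\<not> V \<subseteq> ?comb ` ?C"
    by (meson card_mono finite_PiE finite_imageI finite_lessThan finite_class.finite leD)
  then obtain v where v: "v \<in> V" "v \<notin> ?comb ` ?C" by blast
  have combV: "?comb c \<in> V" for c by (intro V_closed) (use bV in auto)
  define e where "e = v - ?comb (darboux_coord b v)"
  have eV: "e \<in> V" using v combV by (simp add: e_def V_closed)
  have e_orth: "B e (b i) = 0" if "i < 2 * k" for i
    using darboux_residual_orthogonal[OF b that v(1)] by (simp add: e_def)
  have "e \<noteq> 0"
  proof
    assume "e = 0"
    then have "v = ?comb (darboux_coord b v)" by (simp add: e_def)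
    \<comment> \<open>The set of coefficient functions is extensional so that it can be counted;
      hence the restriction.\<close>
    also have "\<dots> = ?comb (restrict (darboux_coord b v) {..<2*k})"
      by (intro sum.cong) auto
    finally show False
      using v(2) image_eqI[of v ?comb "restrict (darboux_coord b v) {..<2*k}" ?C] by simp
  qed
  then obtain y where y: "y \<in> V" "B e y \<noteq> 0" using nondegenerate eV by blast
  define y' where "y' = inverse (B e y) *s y"
  have y'V: "y' \<in> V" using y by (simp add: y'_def V_closed)
  define f where "f = y' - ?comb (darboux_coord b y')"
  have fV: "f \<in> V" using y'V combV by (simp add: f_def V_closed)
  have f_orth: "B f (b i) = 0" if "i < 2 * k" for i
    using darboux_residual_orthogonal[OF b that y'V] by (simp add: f_def)
  \<comment> \<open>Projecting the partner leaves its pairing with \<open>e\<close> unchanged, as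
    \<open>e\<close> is orthogonal to the earlier pairs.\<close>
  have "B e (?comb (darboux_coord b y')) = 0"
    using eV bV e_orth by (subst sum_right) auto
  then have ef: "B e f = 1"
    using y y'V eV combV by (simp add: f_def diff_right y'_def scale_right')
  define b' where "b' = b(2*k := e, Suc (2*k) := f)"
  have b'V: "b' i \<in> V" if "i < 2 * Suc k" for i
    using that eV fV bV by (auto simp: b'_def less_Suc_eq)
  have e_orth': "B (b i) e = 0" and f_orth': "B (b i) f = 0" if "i < 2 * k" for i
    using skew[OF bV[OF that] eV] skew[OF bV[OF that] fV] e_orth f_orth that by auto
  have sp: "swap_pair (2*k) = Suc (2*k)" "swap_pair (Suc (2*k)) = 2*k"
    by (auto simp: swap_pair_def)
  have sp': "2 * k \<noteq> swap_pair i \<and> Suc (2 * k) \<noteq> swap_pair i" if "i < 2 * k" for i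
    using swap_pair_less[of i k] that by linarith
  have form: "B (b' i) (b' j) = darboux_form i j" if i: "i < 2 * Suc k" and j: "j < 2 * Suc k" for i j
  proof -
    have "i < 2*k \<or> i = 2*k \<or> i = Suc (2*k)" "j < 2*k \<or> j = 2*k \<or> j = Suc (2*k)"
      using i j by auto
    then show ?thesis
      using b e_orth f_orth e_orth' f_orth' ef skew[OF fV eV] alternating[OF eV] alternating[OF fV]
        sp'[of i]
      by (elim disjE) (auto simp: b'_def darboux_upto_def darboux_form_def sp)
  qed
  show ?thesis using b'V form by (auto simp: darboux_upto_def)
qed

theorem exists_darboux_basis: "\<exists>b. darboux_upto n b"
proof -
  have "\<exists>b. darboux_upto k b" if "k \<le> n" for k
    using that
  proof (induction k)
    case 0
    show ?case by (simp add: darboux_upto_def)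
  next
    case (Suc k)
    then show ?case using darboux_extend by (metis Suc_le_eq less_imp_le)
  qed
  then show ?thesis by blast
qed

text \<open>Pairing recovers the coefficients, so distinct coefficients give distinct combinations
  and by counting these exhaust \<open>V\<close>. The residual of \<open>v\<close> is orthogonal to
  all of them, hence zero.\<close>

lemma darboux_expansion:
  assumes b: "darboux_upto n b" and v: "v \<in> V"
  shows "v = (\<Sum>j<2*n. darboux_coord b v j *s b j)"
proof -
  have bV: "\<And>j. j < 2 * n \<Longrightarrow> b j \<in> V" using b by (auto simp: darboux_upto_def)
  let ?comb = "\<lambda>c. \<Sum>j<2*n. c j *s b j"
  let ?C = "{..<2*n} \<rightarrow>\<^sub>E (UNIV :: 'f set)"
  have combV: "?comb c \<in> V" for c by (intro V_closed) (use bV in auto)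
  have "inj_on ?comb ?C"
  proof (rule inj_onI)
    fix c d assume cd: "c \<in> ?C" "d \<in> ?C" "?comb c = ?comb d"
    have "c i = d i" if "i < 2 * n" for i
    proof -
      have i: "swap_pair i < 2 * n" using that by simp
      show ?thesis
        using darboux_comb_pairing[OF b i, of c] darboux_comb_pairing[OF b i, of d] cd(3) by simp
    qed
    then show "c = d" using cd(1,2) by (intro PiE_ext) auto
  qed
  then have "card (?comb ` ?C) = card V"
    by (simp add: card_image card_PiE card_V)
  then have "?comb ` ?C = V"
    using combV finite_V by (intro card_subset_eq) auto
  moreover define e where "e = v - ?comb (darboux_coord b v)"
  moreover have eV: "e \<in> V" using v combV by (simp add: e_def V_closed)
  moreover have "B e (?comb c) = 0" for c
    using darboux_residual_orthogonal[OF b _ v] eV bV by (subst sum_right) (auto simp: e_def)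
  ultimately have "e = 0" by (intro nondegenerate) auto
  then show ?thesis by (simp add: e_def)
qed

lemma darboux_form_comb:
  assumes b: "darboux_upto n b"
  shows "B (\<Sum>i<2*n. c i *s b i) (\<Sum>j<2*n. d j *s b j)
    = (\<Sum>i<2*n. c i * (\<Sum>j<2*n. d j * darboux_form i j))"
proof -
  have bV: "\<And>j. j < 2 * n \<Longrightarrow> b j \<in> V" using b by (auto simp: darboux_upto_def)
  have "B (\<Sum>i<2*n. c i *s b i) (\<Sum>j<2*n. d j *s b j)
      = (\<Sum>i<2*n. c i * B (b i) (\<Sum>j<2*n. d j *s b j))"
    using bV by (intro sum_left V_closed) auto
  also have "\<dots> = (\<Sum>i<2*n. c i * (\<Sum>j<2*n. d j * B (b i) (b j)))"
    using bV by (intro sum.cong refl, subst sum_right) auto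
  also have "\<dots> = (\<Sum>i<2*n. c i * (\<Sum>j<2*n. d j * darboux_form i j))"
    using b by (intro sum.cong refl) (auto simp: darboux_upto_def)
  finally show ?thesis .
qed

end

text \<open>A Darboux basis for \<open>B2\<close> is sent to one for \<open>B1\<close>; both have
  the same Gram matrix. Coordinates are values of \<open>B2\<close>, so linearity is inherited from
  \<open>B2\<close>, and injectivity from its non-degeneracy.\<close>

lemma symplectic_isometry:
  assumes "symplectic_space scale V B1 n" "symplectic_space scale V B2 n"
  obtains \<gamma> where "bij_betw \<gamma> V V"
    "\<And>x y. x \<in> V \<Longrightarrow> y \<in> V \<Longrightarrow> \<gamma> (x + y) = \<gamma> x + \<gamma> y"
    "\<And>a x. x \<in> V \<Longrightarrow> \<gamma> (scale a x) = scale a (\<gamma> x)"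
    "\<And>x y. x \<in> V \<Longrightarrow> y \<in> V \<Longrightarrow> B1 (\<gamma> x) (\<gamma> y) = B2 x y"
proof -
  interpret S1: symplectic_space scale V B1 n by fact
  interpret S2: symplectic_space scale V B2 n by fact
  obtain b1 where b1: "S1.darboux_upto n b1" using S1.exists_darboux_basis by blast
  obtain b2 where b2: "S2.darboux_upto n b2" using S2.exists_darboux_basis by blast
  have b1V: "b1 j \<in> V" and b2V: "b2 j \<in> V" if "j < 2 * n" for j
    using b1 b2 that by (auto simp: S1.darboux_upto_def S2.darboux_upto_def)
  have sp: "swap_pair j < 2 * n" if "j < 2 * n" for j using that by simp
  define \<gamma> where "\<gamma> x = (\<Sum>j<2*n. scale (S2.darboux_coord b2 x j) (b1 j))" for x
  have \<gamma>V: "\<gamma> x \<in> V" for x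
    unfolding \<gamma>_def by (intro S1.V_closed) (use b1V in auto)
  have iso: "B1 (\<gamma> x) (\<gamma> y) = B2 x y" if "x \<in> V" "y \<in> V" for x y
    using S1.darboux_form_comb[OF b1, of "S2.darboux_coord b2 x" "S2.darboux_coord b2 y"]
      S2.darboux_form_comb[OF b2, of "S2.darboux_coord b2 x" "S2.darboux_coord b2 y"]
      S2.darboux_expansion[OF b2 that(1)] S2.darboux_expansion[OF b2 that(2)]
    by (simp add: \<gamma>_def)
  have add: "\<gamma> (x + y) = \<gamma> x + \<gamma> y" if "x \<in> V" "y \<in> V" for x y
    unfolding \<gamma>_def sum.distrib[symmetric] using that b2V sp
    by (intro sum.cong refl)
      (simp add: S2.darboux_coord_def S2.add_left distrib_left S1.scale_left_distrib)
  have homog: "\<gamma> (scale a x) = scale a (\<gamma> x)" if "x \<in> V" for a x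
    unfolding \<gamma>_def S1.scale_sum_right using that b2V sp
    by (intro sum.cong refl)
      (simp add: S2.darboux_coord_def S2.scale_left' mult.left_commute)
  have "inj_on \<gamma> V"
  proof (rule inj_onI)
    fix x y assume xy: "x \<in> V" "y \<in> V" "\<gamma> x = \<gamma> y"
    have "B2 (x - y) z = 0" if "z \<in> V" for z
      using iso[of x z] iso[of y z] xy that by (simp add: S2.diff_left)
    then show "x = y" using S2.nondegenerate[of "x - y"] xy by (simp add: S1.V_closed)
  qed
  then have "bij_betw \<gamma> V V"
    using \<gamma>V S1.finite_V by (simp add: bij_betw_def endo_inj_surj image_subset_iff)
  then show ?thesis using that add homog iso by blast
qed

section \<open>The trace form on a finite field\<close>

text \<open>The polynomial splits into linear factors; a factor occurring twice would make its root
  a root of the derivative too.\<close>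

lemma card_roots_eq_degree:
  fixes p :: "'e::alg_closed_field poly"
  assumes "p \<noteq> 0" and sep: "\<And>a. poly p a = 0 \<Longrightarrow> poly (pderiv p) a \<noteq> 0"
  shows "card {x. poly p x = 0} = degree p"
proof -
  obtain A where A: "size A = degree p" "p = smult (lead_coeff p) (\<Prod>x\<in>#A. [:-x, 1:])"
    using alg_closed_imp_factorization[OF assms(1)] by blast
  have "poly p a = lead_coeff p * (\<Prod>x\<in>#A. a - x)" for a
    by (subst A(2)) (simp add: poly_prod_mset image_mset.compositionality o_def)
  then have roots: "{x. poly p x = 0} = set_mset A"
    using assms(1) by auto
  have "count A a = 1" if "a \<in># A" for a
  proof (rule ccontr)
    assume "count A a \<noteq> 1"
    then have "count A a \<ge> 2" using that by (simp add: Suc_le_eq flip: count_greater_zero_iff)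
    then have "{#a, a#} \<subseteq># A" by (auto simp: subseteq_mset_def)
    then obtain A' where "A = {#a, a#} + A'" by (auto simp: subset_mset.le_iff_add)
    then have "p = [:-a, 1:] * ([:-a, 1:] * smult (lead_coeff p) (\<Prod>x\<in>#A'. [:-x, 1:]))"
      by (subst A(2)) simp
    then obtain r where "p = [:-a, 1:] * ([:-a, 1:] * r)" by blast
    then have "poly (pderiv p) a = 0" "poly p a = 0"
      by (simp_all only: pderiv_mult poly_add poly_mult) simp_all
    then show False using sep by blast
  qed
  then have "size A = card (set_mset A)"
    by (simp add: size_multiset_overloaded_eq)
  then show ?thesis using A(1) roots by simp
qed

text \<open>Multiplication by a nonzero \<open>x\<close> permutes the nonzero elements; comparing
  their products gives the claim.\<close>

lemma finite_field_power_card: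
  fixes x :: "'a::{field,finite}"
  shows "x ^ card (UNIV :: 'a set) = x"
proof (cases "x = 0")
  case False
  have "(\<Prod>y\<in>UNIV-{0}. y) = (\<Prod>y\<in>UNIV-{0}. x * y)"
    by (rule prod.reindex_bij_witness[of _ "\<lambda>y. x * y" "\<lambda>y. y / x"]) (use False in auto)
  then have "x ^ (card (UNIV :: 'a set) - 1) = 1"
    by (simp add: prod.distrib)
  moreover have "card (UNIV :: 'a set) = Suc (card (UNIV :: 'a set) - 1)"
    using finite_UNIV_card_ge_0[where ?'a = 'a] by simp
  ultimately show ?thesis by (metis mult.right_neutral power_Suc)
qed (use finite_UNIV_card_ge_0[where ?'a = 'a] in auto)

text \<open>Keeps the conjugates of \<open>w\<close> distinct. Small \<open>d\<close> is excluded by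
  size; for \<open>d = n + e\<close>, the congruence \<open>q^d = - q^e\<close> modulo
  \<open>q^n + 1\<close> would force \<open>q^n + 1\<close> to divide the smaller number
  \<open>q^e + 1\<close>.\<close>

lemma not_dvd_power_minus_one:
  fixes q n d :: nat
  assumes "q \<ge> 2" "0 < d" "d < 2 * n"
  shows "\<not> (q^n + 1) dvd (q^d - 1)"
proof
  assume dvd: "(q^n + 1) dvd (q^d - 1)"
  have qd: "q^d > 1" using assms by (intro one_less_power) auto
  show False
  proof (cases "d \<le> n")
    case True
    then have "q^d \<le> q^n" using assms by (simp add: power_increasing)
    then show False using dvd_imp_le[OF dvd] qd by simp
  next
    case False
    define e where "e = d - n"
    have e: "d = e + n" "e < n" using False assms by (auto simp: e_def)
    have "q^d - 1 + (q^e + 1) = q^e * (q^n + 1)"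
      using qd by (simp add: e power_add algebra_simps)
    then have "(q^n + 1) dvd (q^d - 1) + (q^e + 1)" by (metis dvd_triv_right)
    then have "(q^n + 1) dvd (q^e + 1)" by (rule iffD1[OF dvd_add_right_iff[OF dvd]])
    then have "q^n \<le> q^e" using dvd_imp_le[of "q^n + 1" "q^e + 1"] by simp
    moreover have "q^e < q^n" using e assms by (intro power_strict_increasing) auto
    ultimately show False by simp
  qed
qed

section \<open>The field with \<open>q ^ (2 * n)\<close> elements inside an algebraic
  closure\<close>

locale finite_field_tower =
  fixes ty :: "'a::{field,finite} itself" and q n k :: nat
  assumes n_pos: "n \<ge> 1" and q_card: "q = card (UNIV :: 'a set)"
    and q_power: "q = CHAR('a) ^ k" and q_odd: "odd q"
begin

lemma prime_CHAR: "prime CHAR('a)"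
  using finite_imp_CHAR_pos[where ?'a = 'a] prime_CHAR_semidom[where ?'a = 'a] by simp

lemma q_ge_2: "q \<ge> 2"
  using card_mono[of "UNIV :: 'a set" "{0, 1}"] by (simp add: q_card)

lemma k_pos: "k > 0"
  using q_ge_2 q_power by (cases k) auto

lemma frobenius_add: "((x :: 'a alg_closure) + y) ^ (q^i) = x ^ (q^i) + y ^ (q^i)"
  by (rule freshmans_dream'[of _ "k * i"]) (simp_all add: prime_CHAR q_power power_mult)

lemma frobenius_sum: "(\<Sum>j\<in>A. f j :: 'a alg_closure) ^ (q^i) = (\<Sum>j\<in>A. f j ^ (q^i))"
  by (rule freshmans_dream_sum'[of _ "k * i"]) (simp_all add: prime_CHAR q_power power_mult)

lemma frobenius_minus: "(- (x :: 'a alg_closure)) ^ (q^i) = - (x ^ (q^i))"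
  using q_odd by simp

lemma frobenius_diff: "((x :: 'a alg_closure) - y) ^ (q^i) = x ^ (q^i) - y ^ (q^i)"
  using frobenius_add[of x "- y"] frobenius_minus by simp

lemma frobenius_to_ac: "to_ac (a :: 'a) ^ (q^i) = to_ac a"
proof (induction i)
  case (Suc i)
  have "to_ac a ^ (q^Suc i) = (to_ac a ^ (q^i)) ^ q" by (metis power_Suc2 power_mult)
  also have "\<dots> = to_ac (a ^ q)" by (simp add: Suc)
  finally show ?case by (simp add: q_card finite_field_power_card)
qed simp

text \<open>The base field already supplies \<open>q\<close> roots of \<open>X^q - X\<close>, the
  most this polynomial can have. This is the test for descending to the base field.\<close>

lemma range_to_ac: "range (to_ac :: 'a \<Rightarrow> _) = {x. x ^ q = x}"
proof (rule card_seteq)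
  let ?p = "monom 1 q - monom 1 1 :: 'a alg_closure poly"
  have "coeff ?p q = 1" using q_ge_2 by simp
  then have p: "?p \<noteq> 0" by (metis coeff_0 one_neq_zero)
  have eq: "{x. x ^ q = x} = {x. poly ?p x = 0}" by (simp add: poly_monom)
  then show "finite {x :: 'a alg_closure. x ^ q = x}" using poly_roots_finite[OF p] by simp
  show "range (to_ac :: 'a \<Rightarrow> _) \<subseteq> {x. x ^ q = x}"
    using frobenius_to_ac[of _ 1] by auto
  have "card {x :: 'a alg_closure. x ^ q = x} \<le> degree ?p"
    unfolding eq by (rule card_poly_roots_bound[OF p])
  also have "\<dots> \<le> q" using q_ge_2 by (intro degree_diff_le) (auto simp: degree_monom_eq)
  finally show "card {x :: 'a alg_closure. x ^ q = x} \<le> card (range (to_ac :: 'a \<Rightarrow> _))"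
    by (simp add: q_card card_image inj_to_ac)
qed

text \<open>Being the fixed points of a power of Frobenius, this set is closed under the field
  operations with no construction of an extension.\<close>

definition K :: "'a alg_closure set" where
  "K = {x. x ^ (q ^ (2 * n)) = x}"

text \<open>The derivative of \<open>X^Q - X\<close> is -1 in this characteristic, so all
  \<open>Q\<close> roots are distinct.\<close>

lemma card_K: "card K = q ^ (2 * n)"
proof -
  let ?Q = "q ^ (2 * n)"
  let ?p = "monom 1 ?Q - monom 1 1 :: 'a alg_closure poly"
  have Q: "?Q > 1" using q_ge_2 n_pos by (intro one_less_power) auto
  have deg: "degree ?p = ?Q"
  proof (rule antisym)
    show "degree ?p \<le> ?Q" using Q by (intro degree_diff_le) (auto simp: degree_monom_eq)
    show "?Q \<le> degree ?p" using Q by (intro le_degree) simp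
  qed
  have "of_nat ?Q = (0 :: 'a alg_closure)"
    using k_pos n_pos by (simp add: of_nat_eq_0_iff_char_dvd q_power flip: power_mult)
  then have "pderiv ?p = - 1"
    using n_pos by (simp add: pderiv_diff pderiv_monom monom_0 one_pCons power_0_left)
  then have "card {x. poly ?p x = 0} = degree ?p"
    using deg Q by (intro card_roots_eq_degree) auto
  then show ?thesis using deg by (simp add: K_def poly_monom)
qed

lemma K_closed:
  "0 \<in> K" "1 \<in> K" "x \<in> K \<Longrightarrow> y \<in> K \<Longrightarrow> x + y \<in> K" "x \<in> K \<Longrightarrow> y \<in> K \<Longrightarrow> x - y \<in> K"
  "x \<in> K \<Longrightarrow> - x \<in> K" "x \<in> K \<Longrightarrow> y \<in> K \<Longrightarrow> x * y \<in> K" "x \<in> K \<Longrightarrow> inverse x \<in> K"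
  "x \<in> K \<Longrightarrow> x ^ m \<in> K" "to_ac a \<in> K"
  using q_ge_2
  by (auto simp: K_def frobenius_add frobenius_diff frobenius_minus power_mult_distrib
      power_inverse frobenius_to_ac)
    (metis power_commutes power_mult mult.commute)

lemma exists_generator:
  obtains a where "a \<in> K" "\<And>x. x \<in> K \<Longrightarrow> x \<noteq> 0 \<Longrightarrow> \<exists>i. x = a ^ i"
    "a \<noteq> 0"
proof -
  define R :: "'a alg_closure ring" where
    "R = \<lparr>carrier = K, monoid.mult = (*), one = 1, ring.zero = 0, add = (+)\<rparr>"
  have [simp]: "carrier R = K" "\<one>\<^bsub>R\<^esub> = 1" "\<zero>\<^bsub>R\<^esub> = 0" "x \<otimes>\<^bsub>R\<^esub> y = x * y" "x \<oplus>\<^bsub>R\<^esub> y = x + y" for x y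
    by (simp_all add: R_def)
  have U: "Units R = K - {0}"
  proof -
    have "\<exists>y\<in>K. y * x = 1 \<and> x * y = 1" if "x \<in> K" "x \<noteq> 0" for x
      using that K_closed by (intro bexI[of _ "inverse x"]) auto
    then show ?thesis by (auto simp: Units_def)
  qed
  have add_inv: "\<exists>y\<in>K. y + x = 0 \<and> x + y = 0" if "x \<in> K" for x
    using that K_closed by (intro bexI[of _ "- x"]) auto
  have R: "field R"
    by unfold_locales (use U K_closed add_inv in \<open>auto simp: algebra_simps Units_def add_eq_0_iff\<close>)
  have "finite (carrier R)" using card_K q_ge_2 by (intro card_ge_0_finite) simp
  from field.finite_field_mult_group_has_gen[OF R this]
  obtain a where a: "a \<in> K - {0}" "K - {0} = {a [^]\<^bsub>R\<^esub> i | i::nat. i \<in> UNIV}"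
    by auto blast
  have "a [^]\<^bsub>R\<^esub> (i::nat) = a ^ i" for i
    by (induction i) (simp_all add: mult.commute)
  then show ?thesis using that[of a] a by auto
qed

text \<open>A generator \<open>a\<close> has order \<open>T\<close>, because \<open>a^i = 1\<close>
  would let \<open>i\<close> powers cover all nonzero elements. As
  \<open>T = (q^n - 1) * (q^n + 1)\<close>, the power \<open>a^(q^n - 1)\<close> has order
  \<open>q^n + 1\<close>.\<close>

lemma exists_primitive_root:
  obtains w where "w \<in> K" "w ^ (q^n + 1) = 1" "\<And>i. w ^ i = 1 \<Longrightarrow> (q^n + 1) dvd i"
proof -
  obtain a where a: "a \<in> K" "a \<noteq> 0" and gen: "\<And>x. x \<in> K \<Longrightarrow> x \<noteq> 0 \<Longrightarrow> \<exists>i. x = a ^ i"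
    using exists_generator by blast
  define T where "T = q ^ (2 * n) - 1"
  have Q: "q ^ (2 * n) > 1" using q_ge_2 n_pos by (intro one_less_power) auto
  have T: "q ^ (2 * n) = Suc T" "T > 0" using Q by (auto simp: T_def)
  have aT: "a ^ T = 1" using a by (simp add: K_def T)
  have le: "T \<le> i" if "a ^ i = 1" "i > 0" for i
  proof -
    have "K - {0} \<subseteq> (\<lambda>j. a ^ j) ` {..<i}"
    proof
      fix x assume "x \<in> K - {0}"
      then obtain j where "x = a ^ j" using gen by blast
      also have "\<dots> = (a ^ i) ^ (j div i) * a ^ (j mod i)"
        by (simp flip: power_mult power_add)
      finally have "x = a ^ (j mod i)" using that by simp
      then show "x \<in> (\<lambda>j. a ^ j) ` {..<i}" using that by simp
    qed
    then have "card (K - {0}) \<le> card ((\<lambda>j. a ^ j) ` {..<i})"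
      by (intro card_mono) auto
    also have "\<dots> \<le> i" using card_image_le[of "{..<i}" "\<lambda>j. a ^ j"] by simp
    finally show ?thesis using K_closed(1) by (simp add: card_K T)
  qed
  have dvd: "T dvd i" if "a ^ i = 1" for i
  proof -
    have "a ^ i = (a ^ T) ^ (i div T) * a ^ (i mod T)"
      by (simp flip: power_mult power_add)
    then have "a ^ (i mod T) = 1" using that aT by simp
    then have "i mod T = 0" using le[of "i mod T"] mod_less_divisor[OF T(2), of i] by linarith
    then show ?thesis by auto
  qed
  have qn: "q ^ n > 1" using q_ge_2 n_pos by (intro one_less_power) auto
  have Tf: "T = (q^n - 1) * (q^n + 1)"
  proof -
    obtain m where "q ^ n = Suc m" using qn by (cases "q ^ n") auto
    then show ?thesis by (simp add: T_def mult_2 power_add)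
  qed
  show ?thesis
  proof (rule that[of "a ^ (q^n - 1)"])
    show "a ^ (q^n - 1) \<in> K" using a by (simp add: K_closed)
    show "(a ^ (q^n - 1)) ^ (q^n + 1) = 1" using aT unfolding Tf power_mult .
    show "(q^n + 1) dvd i" if "(a ^ (q^n - 1)) ^ i = 1" for i
    proof -
      have "(q^n - 1) * (q^n + 1) dvd (q^n - 1) * i"
        using dvd[of "(q^n - 1) * i"] that by (simp add: Tf power_mult)
      then show ?thesis using qn by (subst (asm) dvd_times_left_cancel_iff) auto
    qed
  qed
qed

text \<open>Any root of \<open>X^(q^n - 1) = -1\<close> will do. Its skewness under conjugation
  makes the trace form alternating.\<close>

lemma exists_skew_element:
  obtains c :: "'a alg_closure" where "c \<noteq> 0" "c ^ (q^n) = - c"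
proof -
  have qn: "q ^ n > 1" using q_ge_2 n_pos by (intro one_less_power) auto
  obtain c :: "'a alg_closure" where c: "c ^ (q^n - 1) = - 1"
    using nth_root_exists[of "q^n - 1" "- 1"] qn by auto
  have "Suc (q^n - 1) = q^n" using qn by simp
  then have "c ^ (q^n) = c ^ Suc (q^n - 1)" by simp
  also have "\<dots> = - c" by (simp only: power_Suc c) simp
  finally have "c ^ (q^n) = - c" .
  moreover have "c \<noteq> 0" using c qn by (auto simp: power_0_left)
  ultimately show ?thesis using that by blast
qed

section \<open>The trace from K to the base field\<close>

definition tr :: "'a alg_closure \<Rightarrow> 'a alg_closure" where
  "tr y = (\<Sum>i<2*n. y ^ (q^i))"

lemma tr_add: "tr (x + y) = tr x + tr y"
  by (simp add: tr_def frobenius_add sum.distrib)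

lemma tr_diff: "tr (x - y) = tr x - tr y"
  by (simp add: tr_def frobenius_diff sum_subtractf)

lemma tr_minus: "tr (- x) = - tr x"
  by (simp add: tr_def frobenius_minus sum_negf)

lemma tr_scale: "tr (to_ac a * y) = to_ac a * tr y"
  by (simp add: tr_def power_mult_distrib frobenius_to_ac sum_distrib_left)

lemma tr_0 [simp]: "tr 0 = 0"
  using tr_diff[of 0 0] by simp

lemma tr_sum: "tr (\<Sum>i\<in>A. f i) = (\<Sum>i\<in>A. tr (f i))"
  by (induction A rule: infinite_finite_induct) (simp_all add: tr_add)

text \<open>On K the conjugates are permuted cyclically, as \<open>y ^ (q ^ (2 * n)) = y\<close>;
  invariance of the trace and its values in the base field both rest on this.\<close>

lemma sum_frobenius_shift:
  assumes "y \<in> K"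
  shows "(\<Sum>i<2*n. y ^ (q^Suc i)) = tr y"
proof -
  have "y ^ (q^0) + (\<Sum>i<2*n. y ^ (q^Suc i)) = (\<Sum>i<Suc (2*n). y ^ (q^i))"
    by (simp only: sum.lessThan_Suc_shift)
  also have "\<dots> = tr y + y" using assms by (simp add: tr_def K_def)
  finally show ?thesis by simp
qed

lemma tr_frobenius: "y \<in> K \<Longrightarrow> tr (y ^ (q^j)) = tr y"
proof (induction j)
  case (Suc j)
  have "tr (y ^ (q^Suc j)) = (\<Sum>i<2*n. (y ^ (q^j)) ^ (q^Suc i))"
    unfolding tr_def by (intro sum.cong refl) (simp add: mult_ac flip: power_mult)
  also have "\<dots> = tr (y ^ (q^j))"
    by (intro sum_frobenius_shift K_closed(8) Suc.prems)
  finally show ?case using Suc by simp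
qed simp

lemma tr_in_base:
  assumes "y \<in> K"
  shows "to_ac (of_ac (tr y)) = tr y"
proof -
  have "tr y ^ q = (\<Sum>i<2*n. (y ^ (q^i)) ^ q)"
    unfolding tr_def using frobenius_sum[where i = 1] by simp
  also have "\<dots> = (\<Sum>i<2*n. y ^ (q^Suc i))"
    by (simp add: mult_ac flip: power_mult)
  also have "\<dots> = tr y" by (rule sum_frobenius_shift[OF assms])
  finally have "tr y \<in> range (to_ac :: 'a \<Rightarrow> _)" by (simp add: range_to_ac)
  then show ?thesis by (rule to_ac_of_ac)
qed

text \<open>The trace is a nonzero polynomial of degree at most \<open>q ^ (2 * n - 1)\<close>, too
  small to vanish on all of K.\<close>

lemma exists_tr_nonzero: "\<exists>z\<in>K. tr z \<noteq> 0"
proof (rule ccontr)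
  assume "\<not> (\<exists>z\<in>K. tr z \<noteq> 0)"
  then have zero: "tr z = 0" if "z \<in> K" for z using that by blast
  define P :: "'a alg_closure poly" where "P = (\<Sum>i<2*n. monom 1 (q^i))"
  have poly_P: "poly P z = tr z" for z by (simp add: P_def tr_def poly_sum poly_monom)
  have "coeff P 1 = (\<Sum>i<2*n. if i = 0 then 1 else 0)"
    unfolding P_def coeff_sum using q_ge_2 by (intro sum.cong refl) auto
  also have "\<dots> = 1" using n_pos by simp
  finally have P: "P \<noteq> 0" by (metis coeff_0 one_neq_zero)
  have "K \<subseteq> {z. poly P z = 0}" using zero by (auto simp: poly_P)
  then have "card K \<le> card {z. poly P z = 0}" by (intro card_mono poly_roots_finite P)
  also have "\<dots> \<le> degree P" by (rule card_poly_roots_bound[OF P])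
  also have "\<dots> \<le> q ^ (2 * n - 1)"
    unfolding P_def
  proof (intro degree_sum_le)
    fix i assume "i \<in> {..<2*n}"
    then have "q ^ i \<le> q ^ (2 * n - 1)" using q_ge_2 by (intro power_increasing) auto
    then show "degree (monom 1 (q^i) :: 'a alg_closure poly) \<le> q ^ (2 * n - 1)"
      using degree_monom_le order_trans by blast
  qed simp
  also have "\<dots> < q ^ (2 * n)" using q_ge_2 n_pos by (intro power_strict_increasing) auto
  finally show False by (simp add: card_K)
qed

lemma vector_space_to_ac: "vector_space (\<lambda>a x. to_ac (a :: 'a) * x)"
  by unfold_locales (simp_all add: algebra_simps)

end

section \<open>The trace form and the cyclic torus generated by \<open>w\<close>\<close>

locale torus = finite_field_tower ty q n k
  for ty :: "'a::{field,finite} itself" and q n k :: nat +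
  fixes w c :: "'a alg_closure"
  assumes w_K: "w \<in> K" and w_root: "w ^ (q^n + 1) = 1"
    and w_order: "\<And>i. w ^ i = 1 \<Longrightarrow> (q^n + 1) dvd i"
    and c_nz: "c \<noteq> 0" and c_skew: "c ^ (q^n) = - c"
begin

lemma power_q_2n: "x ^ (q ^ (2 * n)) = (x ^ (q^n)) ^ (q^n)" for x :: "'a alg_closure"
  by (simp add: mult_2 power_add power_mult)

lemma c_K: "c \<in> K"
  by (simp only: K_def mem_Collect_eq power_q_2n c_skew frobenius_minus minus_minus)

lemma w_nz: "w \<noteq> 0"
  using w_root by (auto simp: power_0_left)

text \<open>The trace of the skew-Hermitian form \<open>c x y^(q^n)\<close>, where
  \<open>y^(q^n)\<close> is the conjugate of \<open>y\<close> over the subfield of order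
  \<open>q^n\<close>. \<open>of_ac\<close> brings the value back to the base type, which is
  meaningful for arguments in K.\<close>

definition form :: "'a alg_closure \<Rightarrow> 'a alg_closure \<Rightarrow> 'a" where
  "form x y = of_ac (tr (c * x * y ^ (q^n)))"

lemma to_ac_form: "x \<in> K \<Longrightarrow> y \<in> K \<Longrightarrow> to_ac (form x y) = tr (c * x * y ^ (q^n))"
  unfolding form_def by (intro tr_in_base K_closed c_K)

lemma tr_nondegenerate:
  assumes "d \<in> K" "d \<noteq> 0"
  shows "\<exists>y\<in>K. tr (c * y * d) \<noteq> 0"
proof -
  obtain z where z: "z \<in> K" "tr z \<noteq> 0" using exists_tr_nonzero by blast
  have "z * inverse c * inverse d \<in> K" using z assms c_K K_closed by simp
  moreover have "c * (z * inverse c * inverse d) * d = z" using assms c_nz by simp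
  ultimately show ?thesis using z by metis
qed

lemma inverse_frobenius_K: "y \<in> K \<Longrightarrow> (y ^ (q^n)) ^ (q^n) = y"
  by (simp add: K_def flip: power_q_2n)

lemma symplectic_space_form: "symplectic_space (\<lambda>a x. to_ac (a :: 'a) * x) K form n"
proof -
  interpret vector_space "\<lambda>a x. to_ac (a :: 'a) * x" by (rule vector_space_to_ac)
  note K_closed [simp] c_K [simp]
  show ?thesis
  proof unfold_locales
    show "subspace K" by (auto simp: subspace_def)
    show "card K = card (UNIV :: 'a set) ^ (2 * n)" by (simp only: card_K q_card[symmetric])
  next
    fix x y z assume "x \<in> K" "y \<in> K" "z \<in> K"
    then have "to_ac (form (x + y) z) = to_ac (form x z + form y z)"
      "to_ac (form x (y + z)) = to_ac (form x y + form x z)"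
      by (simp_all add: to_ac_form frobenius_add tr_add distrib_left distrib_right)
    then show "form (x + y) z = form x z + form y z" "form x (y + z) = form x y + form x z"
      by (simp_all only: to_ac_eq_iff)
  next
    fix a :: 'a and x y assume "x \<in> K" "y \<in> K"
    moreover have "c * (to_ac a * x) * y ^ (q^n) = to_ac a * (c * x * y ^ (q^n))"
      "c * x * (to_ac a * y) ^ (q^n) = to_ac a * (c * x * y ^ (q^n))"
      by (simp_all add: power_mult_distrib frobenius_to_ac)
    ultimately have "to_ac (form (to_ac a * x) y) = to_ac (a * form x y)"
      "to_ac (form x (to_ac a * y)) = to_ac (a * form x y)"
      by (simp_all only: to_ac_form K_closed tr_scale to_ac_mult)
    then show "form (to_ac a * x) y = a * form x y" "form x (to_ac a * y) = a * form x y"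
      by (simp_all only: to_ac_eq_iff)
  next
    fix x assume x: "x \<in> K"
    let ?y = "c * x * x ^ (q^n)"
    \<comment> \<open>Conjugation negates this element but preserves its trace, so twice the trace
      vanishes; odd characteristic then finishes.\<close>
    have "?y ^ (q^n) = - ?y"
      using x by (simp add: power_mult_distrib c_skew inverse_frobenius_K)
    then have "tr ?y = - tr ?y"
      using tr_frobenius[of ?y n] x by (simp add: tr_minus)
    then have "2 * tr ?y = 0" by (simp add: eq_neg_iff_add_eq_0)
    moreover have "(2 :: 'a alg_closure) \<noteq> 0"
    proof
      assume "(2 :: 'a alg_closure) = 0"
      then have "CHAR('a) dvd 2"
        using of_nat_eq_0_iff_char_dvd[of 2, where 'a = "'a alg_closure"] by simp
      then have "CHAR('a) = 2" using primes_dvd_imp_eq prime_CHAR two_is_prime_nat by blast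
      then show False using q_odd q_power k_pos by simp
    qed
    ultimately have "tr ?y = 0" by simp
    then show "form x x = 0" by (simp add: form_def)
  next
    fix x assume x: "x \<in> K" and zero: "\<And>y. y \<in> K \<Longrightarrow> form x y = 0"
    show "x = 0"
    proof (rule ccontr)
      assume "x \<noteq> 0"
      then obtain y where y: "y \<in> K" "tr (c * y * x) \<noteq> 0" using tr_nondegenerate x by blast
      \<comment> \<open>The conjugate of \<open>y\<close> is inserted so that the conjugation built
        into \<open>form\<close> returns \<open>y\<close>.\<close>
      have "to_ac (form x (y ^ (q^n))) = tr (c * y * x)"
        using x y by (simp add: to_ac_form inverse_frobenius_K mult_ac)
      then show False using zero y by simp
    qed
  qed
qed

lemma form_w:
  assumes "x \<in> K" "y \<in> K"
  shows "form (w * x) (w * y) = form x y"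
proof -
  have "c * (w * x) * (w * y) ^ (q^n) = c * x * y ^ (q^n) * w ^ (q^n + 1)"
    by (simp add: power_mult_distrib)
  then show ?thesis by (simp only: form_def w_root) simp
qed

text \<open>Equality of two conjugates would make \<open>q^n + 1\<close> divide
  \<open>(q^d - 1) * q^i\<close> with \<open>0 < d < 2 n\<close>; the factor \<open>q^i\<close> is
  coprime to it.\<close>

lemma inj_conjugates: "inj_on (\<lambda>i. w ^ (q^i)) {..<2*n}"
proof -
  have aux: "w ^ (q^i) \<noteq> w ^ (q^j)" if "i < j" "j < 2 * n" for i j
  proof
    assume eq: "w ^ (q^i) = w ^ (q^j)"
    define d where "d = j - i"
    have d: "0 < d" "d < 2 * n" "j = d + i" using that by (auto simp: d_def)
    have qd: "q ^ d > 1" using q_ge_2 d by (intro one_less_power) auto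
    have "w ^ (q^j) = w ^ ((q^d - 1) * q^i) * w ^ (q^i)"
    proof -
      obtain m where "q ^ d = Suc m" using qd by (cases "q ^ d") auto
      then show ?thesis by (simp add: d power_add mult.commute)
    qed
    then have "w ^ ((q^d - 1) * q^i) = 1" using eq w_nz by simp
    then have "(q^n + 1) dvd (q^d - 1) * q^i" by (rule w_order)
    moreover have "coprime (q^n + 1) (q^i)"
    proof -
      have "coprime (m + 1) m" for m :: nat by simp
      from this[of "q^n"] show ?thesis using n_pos by simp
    qed
    ultimately have "(q^n + 1) dvd (q^d - 1)" using coprime_dvd_mult_left_iff by blast
    then show False using not_dvd_power_minus_one q_ge_2 d by blast
  qed
  show ?thesis
    by (rule inj_onI) (metis aux lessThan_iff linorder_neqE_nat)
qed

text \<open>A relation is a polynomial of degree below \<open>2 * n\<close> over the base field.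
  Frobenius makes each of the \<open>2 * n\<close> distinct conjugates of \<open>w\<close> a root,
  so it vanishes.\<close>

lemma powers_independent:
  assumes "(\<Sum>i<2*n. to_ac (a i :: 'a) * w ^ i) = 0" "i < 2 * n"
  shows "a i = 0"
proof -
  define P where "P = (\<Sum>i<2*n. monom (to_ac (a i)) i)"
  have root: "poly P (w ^ (q^j)) = 0" for j
  proof -
    have "poly P (w ^ (q^j)) = (\<Sum>i<2*n. (to_ac (a i) * w ^ i) ^ (q^j))"
      by (simp add: P_def poly_sum poly_monom power_mult_distrib frobenius_to_ac mult_ac
          flip: power_mult)
    also have "\<dots> = 0" using assms(1) q_ge_2 by (simp flip: frobenius_sum)
    finally show ?thesis .
  qed
  have "P = 0"
  proof (rule ccontr)
    assume P: "P \<noteq> 0"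
    have "2 * n = card ((\<lambda>i. w ^ (q^i)) ` {..<2*n})" by (simp add: card_image inj_conjugates)
    also have "\<dots> \<le> card {x. poly P x = 0}"
      using root by (intro card_mono poly_roots_finite P) auto
    also have "\<dots> \<le> degree P" by (rule card_poly_roots_bound[OF P])
    also have "\<dots> \<le> 2 * n - 1"
      unfolding P_def by (intro degree_sum_le) (auto intro: order_trans[OF degree_monom_le])
    finally show False using n_pos by simp
  qed
  moreover have "coeff P i = to_ac (a i)"
    using assms(2) by (simp add: P_def coeff_sum)
  ultimately show ?thesis by simp
qed

lemma powers_span:
  assumes "x \<in> K"
  shows "\<exists>a :: nat \<Rightarrow> 'a. x = (\<Sum>i<2*n. to_ac (a i) * w ^ i)"
proof -
  let ?comb = "\<lambda>a :: nat \<Rightarrow> 'a. \<Sum>i<2*n. to_ac (a i) * w ^ i"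
  let ?C = "{..<2*n} \<rightarrow>\<^sub>E (UNIV :: 'a set)"
  interpret S: symplectic_space "\<lambda>a x. to_ac (a :: 'a) * x" K form n
    by (rule symplectic_space_form)
  have "inj_on ?comb ?C"
  proof (rule inj_onI)
    fix a b assume ab: "a \<in> ?C" "b \<in> ?C" "?comb a = ?comb b"
    then have "(\<Sum>i<2*n. to_ac (a i - b i) * w ^ i) = 0"
      by (simp add: left_diff_distrib sum_subtractf)
    from powers_independent[OF this] show "a = b" using ab(1,2) by (intro PiE_ext) auto
  qed
  then have "card (?comb ` ?C) = card K"
    by (simp add: card_image card_PiE card_K flip: q_card)
  moreover have "?comb ` ?C \<subseteq> K"
    using w_K K_closed by (auto intro!: S.V_closed)
  ultimately have "?comb ` ?C = K"
    using S.finite_V by (intro card_subset_eq) auto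
  then show ?thesis using assms by blast
qed

end

section \<open>Bounding the normaliser of the torus\<close>

context torus
begin

definition linear_isometry :: "('a alg_closure \<Rightarrow> 'a alg_closure) \<Rightarrow> bool" where
  "linear_isometry h \<longleftrightarrow> bij_betw h K K \<and>
     (\<forall>x\<in>K. \<forall>y\<in>K. h (x + y) = h x + h y \<and> form (h x) (h y) = form x y) \<and>
     (\<forall>a. \<forall>x\<in>K. h (to_ac a * x) = to_ac a * h x)"

lemma linear_isometry_sum:
  assumes h: "linear_isometry h" and z: "\<And>x. x \<in> K \<Longrightarrow> h (w * x) = z * h x"
  shows "h (\<Sum>i<m. to_ac (a i) * w ^ i) = (\<Sum>i<m. to_ac (a i) * z ^ i) * h 1"
proof (induction m)
  case 0
  have "h (to_ac 0 * 1) = to_ac 0 * h 1" using h K_closed(2) unfolding linear_isometry_def by blast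
  then show ?case by simp
next
  case (Suc m)
  have S: "(\<Sum>i<m. to_ac (a i) * w ^ i) \<in> K"
    by (induction m) (simp_all add: K_closed w_K)
  have pow: "h (w ^ i) = z ^ i * h 1" for i
    by (induction i) (simp_all add: z K_closed w_K mult.assoc)
  have "h (to_ac (a m) * w ^ m) = to_ac (a m) * h (w ^ m)"
    using h K_closed(8)[OF w_K] unfolding linear_isometry_def by blast
  then show ?case
    using h Suc S K_closed w_K unfolding linear_isometry_def by (simp add: pow distrib_right)
qed

text \<open>An isometry normalising \<open>w\<close> is determined by the conjugate \<open>z\<close> of \<open>w\<close> and by
  the image \<open>u\<close> of \<open>1\<close>; here \<open>z\<close> is a root of the minimal polynomial
  of \<open>w\<close>, and the norm \<open>u ^ (q^n + 1)\<close> depends only on \<open>z\<close>.\<close>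

lemma card_normalizer_le:
  fixes H :: "'g \<Rightarrow> 'a alg_closure \<Rightarrow> 'a alg_closure"
  assumes iso: "\<And>g. g \<in> G \<Longrightarrow> linear_isometry (H g)"
    and normal: "\<And>g. g \<in> G \<Longrightarrow> \<exists>z. \<forall>x\<in>K. H g (w * x) = z * H g x"
    and inj: "\<And>g g'. g \<in> G \<Longrightarrow> g' \<in> G \<Longrightarrow> (\<And>x. x \<in> K \<Longrightarrow> H g x = H g' x) \<Longrightarrow> g = g'"
  shows "card G \<le> 2 * n * (q^n + 1)"
proof -
  obtain z where z: "\<And>g x. g \<in> G \<Longrightarrow> x \<in> K \<Longrightarrow> H g (w * x) = z g * H g x"
    using normal by metis
  define u where "u g = H g 1" for g
  have bij: "bij_betw (H g) K K" if "g \<in> G" for g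
    using iso[OF that] by (simp add: linear_isometry_def)
  have u_K: "u g \<in> K" if "g \<in> G" for g
    using bij[OF that] K_closed(2) unfolding u_def bij_betw_def by blast
  have comb: "H g (\<Sum>i<m. to_ac (a i) * w ^ i) = (\<Sum>i<m. to_ac (a i) * z g ^ i) * u g"
    if "g \<in> G" for g m a
    unfolding u_def by (rule linear_isometry_sum[OF iso[OF that] z[OF that]])
  have u_nz: "u g \<noteq> 0" if "g \<in> G" for g
  proof
    assume "u g = 0"
    moreover have "H g 0 = 0" using comb[OF that, of _ 0] by simp
    ultimately have "(1 :: 'a alg_closure) = 0"
      using bij[OF that] K_closed(1,2) unfolding bij_betw_def u_def by (metis inj_onD)
    then show False by simp
  qed
  have pow: "H g (w ^ i) = z g ^ i * u g" if "g \<in> G" for g i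
    unfolding u_def by (induction i) (simp_all add: z[OF that] K_closed w_K mult.assoc)
  \<comment> \<open>A monic relation of degree \<open>2 * n\<close> for \<open>w\<close>; applying
    \<open>H g\<close> to it makes every \<open>z g\<close> a root.\<close>
  obtain m :: "nat \<Rightarrow> 'a" where m: "w ^ (2*n) = (\<Sum>i<2*n. to_ac (m i) * w ^ i)"
    using powers_span K_closed(8)[OF w_K] by blast
  define P where "P = monom 1 (2*n) - (\<Sum>i<2*n. monom (to_ac (m i)) i)"
  have "coeff P (2*n) = 1" by (simp add: P_def coeff_sum)
  then have P: "P \<noteq> 0" by (metis coeff_0 one_neq_zero)
  have degP: "degree P \<le> 2 * n"
    unfolding P_def by (intro degree_diff_le degree_sum_le) (auto intro: order_trans[OF degree_monom_le])
  have z_root: "poly P (z g) = 0" if "g \<in> G" for g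
  proof -
    have "z g ^ (2*n) * u g = H g (w ^ (2*n))" by (simp only: pow[OF that])
    also have "\<dots> = (\<Sum>i<2*n. to_ac (m i) * z g ^ i) * u g"
      unfolding m by (rule comb[OF that])
    finally show ?thesis using u_nz[OF that] by (simp add: P_def poly_sum poly_monom)
  qed
  \<comment> \<open>Pairing the images of \<open>w^i\<close> and 1 shows that the trace of
    \<open>c z^i u^(q^n + 1)\<close> is the same for both elements. The difference \<open>d\<close>
    of the norms is then annihilated by all \<open>z^i\<close>.\<close>
  have norm_eq: "u g ^ (q^n + 1) = u g' ^ (q^n + 1)"
    if g: "g \<in> G" "g' \<in> G" and zz: "z g = z g'" for g g'
  proof (rule ccontr)
    define d where "d = u g ^ (q^n + 1) - u g' ^ (q^n + 1)"
    assume "u g ^ (q^n + 1) \<noteq> u g' ^ (q^n + 1)"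
    then have d: "d \<in> K" "d \<noteq> 0" using u_K g by (auto simp: d_def intro!: K_closed simp del: power_Suc)
    have eq: "tr (c * z g ^ i * u g ^ (q^n + 1)) = tr (c * z g ^ i * u g' ^ (q^n + 1))" for i
    proof -
      have HK: "H h x \<in> K" if "h \<in> G" "x \<in> K" for h x
        using bij[OF that(1)] that(2) unfolding bij_betw_def by blast
      have wi: "w ^ i \<in> K" by (rule K_closed(8)[OF w_K])
      have "to_ac (form (H h (w ^ i)) (H h 1)) = tr (c * z h ^ i * u h ^ (q^n + 1))" if "h \<in> G" for h
        using to_ac_form[OF HK[OF that wi] HK[OF that K_closed(2)]] pow[OF that]
        by (simp add: u_def mult_ac)
      moreover have "form (H h (w ^ i)) (H h 1) = form (w ^ i) 1" if "h \<in> G" for h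
        using iso[OF that] wi K_closed(2) unfolding linear_isometry_def by blast
      ultimately show ?thesis using g zz by metis
    qed
    have eq0: "tr (c * z g ^ i * d) = 0" for i
      using eq[of i] by (simp add: d_def right_diff_distrib tr_diff)
    obtain y where y: "y \<in> K" "tr (c * y * d) \<noteq> 0" using tr_nondegenerate d by blast
    \<comment> \<open>Surjectivity of \<open>H g\<close> yields \<open>x\<close> with
      \<open>H g x = y * u g\<close>; expanding \<open>x\<close> in powers of \<open>w\<close>
      writes \<open>y\<close> in powers of \<open>z g\<close>, which therefore span K.\<close>
    have "y * u g \<in> H g ` K"
      using bij_betw_imp_surj_on[OF bij[OF g(1)]] K_closed(6)[OF y(1) u_K[OF g(1)]] by simp
    then obtain x where x: "x \<in> K" "y * u g = H g x" by auto
    obtain a :: "nat \<Rightarrow> 'a" where a: "x = (\<Sum>i<2*n. to_ac (a i) * w ^ i)"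
      using powers_span x(1) by blast
    have "y = (\<Sum>i<2*n. to_ac (a i) * z g ^ i)"
      using x(2) comb[OF g(1), of a "2*n"] u_nz[OF g(1)] a by simp
    then have "c * y * d = (\<Sum>i<2*n. to_ac (a i) * (c * z g ^ i * d))"
      by (simp add: sum_distrib_left sum_distrib_right mult_ac)
    then have "tr (c * y * d) = 0" by (simp add: tr_sum tr_scale eq0)
    then show False using y by simp
  qed
  define f where "f g = (z g, u g)" for g
  have "inj_on f G"
  proof (rule inj_onI)
    fix g g' assume g: "g \<in> G" "g' \<in> G" "f g = f g'"
    have "H g x = H g' x" if xK: "x \<in> K" for x
    proof -
      obtain a :: "nat \<Rightarrow> 'a" where "x = (\<Sum>i<2*n. to_ac (a i) * w ^ i)"
        using powers_span[OF xK] by blast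
      then show ?thesis using comb g by (simp add: f_def)
    qed
    then show "g = g'" by (rule inj[OF g(1,2)])
  qed
  define Z where "Z = {x. poly P x = 0}"
  define U where "U x = {y. (x, y) \<in> f ` G}" for x
  have finZ: "finite Z" and cardZ: "card Z \<le> 2 * n"
    unfolding Z_def using poly_roots_finite[OF P] card_poly_roots_bound[OF P] degP by auto
  have U: "finite (U x) \<and> card (U x) \<le> q^n + 1" for x
  proof (cases "U x = {}")
    case False
    then obtain g where g: "g \<in> G" "z g = x" by (auto simp: U_def f_def)
    \<comment> \<open>For fixed \<open>z\<close> all images \<open>u\<close> of 1 share one norm,
      hence are roots of this polynomial.\<close>
    define R where "R = monom 1 (q^n + 1) - [:u g ^ (q^n + 1):]"
    have "coeff R (q^n + 1) = 1" by (simp add: R_def coeff_pCons)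
    then have R: "R \<noteq> 0" by (metis coeff_0 one_neq_zero)
    have degR: "degree R \<le> q^n + 1"
      unfolding R_def by (intro degree_diff_le) (auto intro: degree_monom_le)
    have "U x \<subseteq> {y. poly R y = 0}"
      using norm_eq[OF _ g(1)] g(2) by (auto simp: U_def f_def R_def poly_monom simp del: power_Suc)
    then show ?thesis
      using poly_roots_finite[OF R] card_poly_roots_bound[OF R] degR
      by (meson card_mono finite_subset le_trans)
  qed simp
  have "f ` G \<subseteq> Sigma Z U"
    using z_root by (auto simp: Z_def U_def f_def)
  moreover have "finite (Sigma Z U)" using finZ U by auto
  ultimately have "card (f ` G) \<le> card (Sigma Z U)" by (rule card_mono[rotated])
  also have "\<dots> = (\<Sum>x\<in>Z. card (U x))" using finZ U by (intro card_SigmaI) auto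
  also have "\<dots> \<le> card Z * (q^n + 1)" using U sum_bounded_above[of Z "\<lambda>x. card (U x)" "q^n + 1"] by simp
  also have "\<dots> \<le> 2 * n * (q^n + 1)" using cardZ by (rule mult_right_mono) simp
  finally show ?thesis using \<open>inj_on f G\<close> by (simp add: card_image)
qed

end

section \<open>Orders of the conjugates of a cyclic subgroup\<close>

context group
begin

text \<open>Conjugacy is written as an intertwining relation, through which powers pass without
  inverses.\<close>

lemma intertwine_pow:
  assumes "h \<otimes> a = b \<otimes> h" "h \<in> carrier G" "a \<in> carrier G" "b \<in> carrier G"
  shows "h \<otimes> a [^] (i::nat) = b [^] i \<otimes> h"
proof (induction i)
  case (Suc i)
  have "h \<otimes> a [^] Suc i = (h \<otimes> a [^] i) \<otimes> a" using assms by (simp add: m_assoc)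
  also have "\<dots> = b [^] i \<otimes> (h \<otimes> a)" using assms Suc by (simp add: m_assoc)
  also have "\<dots> = b [^] Suc i \<otimes> h" using assms by (simp add: m_assoc)
  finally show ?case .
qed (use assms in simp)

lemma pow_mod_ord:
  assumes "a \<in> carrier G"
  shows "a [^] (k mod ord a) = a [^] (k::nat)"
proof -
  have "a [^] k = a [^] (ord a * (k div ord a) + k mod ord a)" by simp
  also have "\<dots> = (a [^] ord a) [^] (k div ord a) \<otimes> a [^] (k mod ord a)"
    using assms by (simp only: nat_pow_mult nat_pow_pow nat_pow_closed)
  finally show ?thesis using assms by simp
qed

lemma ord_intertwine:
  assumes "h \<otimes> a = b \<otimes> h" "h \<in> carrier G" "a \<in> carrier G" "b \<in> carrier G"
  shows "ord b = ord a"
proof -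
  have "b [^] i = \<one> \<longleftrightarrow> a [^] i = \<one>" for i :: nat
  proof -
    have "b [^] i = \<one> \<longleftrightarrow> b [^] i \<otimes> h = \<one> \<otimes> h" using assms by (subst right_cancel) auto
    also have "\<dots> \<longleftrightarrow> h \<otimes> a [^] i = h \<otimes> \<one>" using assms by (simp add: intertwine_pow)
    also have "\<dots> \<longleftrightarrow> a [^] i = \<one>" using assms by (simp del: r_one)
    finally show ?thesis .
  qed
  then show ?thesis using assms by (simp add: ord_unique pow_eq_id)
qed

text \<open>Count the pairs of a group element \<open>h\<close> and a generator \<open>M ^ j\<close> of the cyclic
  group of \<open>M\<close>: the fibres of \<open>(h, j) \<mapsto> h M ^ j h\<^sup>-\<^sup>1\<close> inject into the normaliser
  of that cyclic group.\<close>

lemma avg_order_ge_totient: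
  assumes fin: "finite (carrier G)" and M: "M \<in> carrier G"
    and normalizer: "card {h \<in> carrier G. \<exists>j::nat. h \<otimes> M = M [^] j \<otimes> h} \<le> b * ord M"
    and b: "b > 0"
  shows "avg_order G \<ge> real (totient (ord M)) / real b"
proof -
  define N where "N = ord M"
  have N: "N > 0" unfolding N_def using ord_ge_1[OF fin M] by simp
  define E where "E = {x \<in> carrier G. ord x = N}"
  define W where "W = {h \<in> carrier G. \<exists>j::nat. h \<otimes> M = M [^] j \<otimes> h}"
  define F where "F = (\<lambda>(h, j::nat). h \<otimes> M [^] j \<otimes> inv h)"
  define S where "S = carrier G \<times> totatives N"
  have finS: "finite S" and finX: "finite E" and finW: "finite W"
    using fin by (auto simp: S_def E_def W_def)
  have twine: "h \<otimes> M [^] j = F (h, j) \<otimes> h" and F_closed: "F (h, j) \<in> carrier G"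
    if "h \<in> carrier G" for h j
    using that M by (auto simp: F_def m_assoc)
  have ordj: "ord (M [^] j) = N" if "j \<in> totatives N" for j
    using that pow_ord_eq_ord_iff[OF fin M, of j] by (simp add: N_def totatives_def)
  have FX: "F ` S \<subseteq> E"
  proof
    fix x assume "x \<in> F ` S"
    then obtain h j where hj: "h \<in> carrier G" "j \<in> totatives N" "x = F (h, j)" by (auto simp: S_def)
    then show "x \<in> E"
      using ord_intertwine[OF twine[OF hj(1), of j]] M F_closed ordj by (simp add: E_def)
  qed
  have fibre: "card {s \<in> S. F s = x} \<le> b * N" for x
  proof (cases "{s \<in> S. F s = x} = {}")
    case False
    then obtain h0 j0 where hj0: "h0 \<in> carrier G" "j0 \<in> totatives N" "F (h0, j0) = x"
      by (auto simp: S_def)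
    \<comment> \<open>Raising to the power \<open>i\<close> recovers \<open>M\<close> from
      \<open>M^j0\<close>, so whatever carries \<open>M^j0\<close> into the cyclic group also
      carries \<open>M\<close> there.\<close>
    obtain i where i: "[j0 * i = 1] (mod N)"
      using hj0(2) cong_solve_coprime_nat[of j0 N] by (auto simp: totatives_def)
    have Mi: "(M [^] j0) [^] i = M"
    proof -
      have "M [^] (j0 * i) = M [^] (1::nat)"
        using i M pow_mod_ord[of M "j0 * i"] pow_mod_ord[of M 1] by (simp add: unique_euclidean_semiring_class.cong_def N_def)
      then show ?thesis using M by (simp add: nat_pow_pow)
    qed
    \<comment> \<open>If \<open>(h, j)\<close> and \<open>(h0, j0)\<close> give the same conjugate
      \<open>x\<close>, then \<open>inv h \<otimes> h0\<close> carries \<open>M^j0\<close> to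
      \<open>M^j\<close>.\<close>
    define D where "D = (\<lambda>(h, j::nat). inv h \<otimes> h0)"
    have tw: "D (h, j) \<otimes> M [^] j0 = M [^] j \<otimes> D (h, j)"
      if "h \<in> carrier G" "F (h, j) = x" for h j
    proof -
      have "inv h \<otimes> (h0 \<otimes> M [^] j0) = inv h \<otimes> x \<otimes> h0"
        using twine[OF hj0(1), of j0] hj0 that F_closed[of h j] by (simp add: m_assoc)
      also have "inv h \<otimes> x = M [^] j \<otimes> inv h"
      proof -
        have "x = h \<otimes> (M [^] j \<otimes> inv h)" using that M by (auto simp: F_def m_assoc)
        then show ?thesis using that M by (simp add: m_assoc[symmetric])
      qed
      finally show ?thesis using that M hj0 by (simp add: D_def m_assoc)
    qed
    have "D ` {s \<in> S. F s = x} \<subseteq> W"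
    proof
      fix g assume "g \<in> D ` {s \<in> S. F s = x}"
      then obtain h j where hj: "h \<in> carrier G" "F (h, j) = x" "g = D (h, j)"
        by (auto simp: S_def)
      have g: "g \<in> carrier G" using hj hj0 by (simp add: D_def)
      have "g \<otimes> (M [^] j0) [^] i = (M [^] j) [^] i \<otimes> g"
        using tw[OF hj(1,2)] g M hj(3) by (intro intertwine_pow) auto
      then have "g \<otimes> M = M [^] (j * i) \<otimes> g" using Mi M by (simp add: nat_pow_pow)
      then show "g \<in> W" using g by (auto simp: W_def)
    qed
    moreover have "inj_on D {s \<in> S. F s = x}"
    proof (rule inj_onI, clarify)
      fix h j h' j'
      assume hj: "(h, j) \<in> S" "(h', j') \<in> S" "x = F (h, j)" "F (h', j') = F (h, j)" "D (h, j) = D (h', j')"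
      have hc: "h \<in> carrier G" "h' \<in> carrier G" "j \<in> totatives N" "j' \<in> totatives N"
        using hj by (auto simp: S_def)
      have "inv h = inv h'" using hj(5) hc hj0 by (simp add: D_def)
      then have hh: "h = h'" using hc by (metis inv_inv)
      then have "h \<otimes> M [^] j = h \<otimes> M [^] j'" using hj(4) hc twine by metis
      then have "M [^] j = M [^] j'" using hc M by simp
      \<comment> \<open>Totatives lie in \<open>1..N\<close>, a range on which the powers of
        \<open>M\<close> are distinct.\<close>
      moreover have "j \<in> {1..ord M}" "j' \<in> {1..ord M}"
        using hc(3,4) by (auto simp: totatives_def N_def)
      ultimately have "j = j'" using inj_onD[OF ord_inj'[OF M], of j j'] by simp
      then show "h = h' \<and> j = j'" using hh by simp
    qed
    ultimately have "card {s \<in> S. F s = x} \<le> card W" using finW by (intro card_inj_on_le)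
    then show ?thesis using normalizer by (simp add: W_def N_def)
  next
    case True
    then show ?thesis by (simp only: card.empty)
  qed
  have "card (carrier G) * totient N = card S" by (simp add: S_def totient_def card_cartesian_product)
  also have "\<dots> = (\<Sum>x\<in>E. card {s \<in> S. F s = x})"
    using sum.group[OF finS finX FX, of "\<lambda>_. 1::nat"] by simp
  also have "\<dots> \<le> card E * (b * N)" using sum_bounded_above[of E, OF fibre] by simp
  finally have "real (card (carrier G) * totient N) \<le> real (card E * (b * N))"
    by (rule of_nat_mono)
  then have count: "real (card (carrier G)) * real (totient N) \<le> real (card E) * real N * real b"
    by (simp add: mult_ac)
  have cG: "card (carrier G) > 0" using fin M by (auto simp: card_gt_0_iff)
  \<comment> \<open>The \<open>N\<close> in the fibre bound \<open>b * N\<close> is matched by the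
    order \<open>N\<close> that each element of \<open>E\<close> contributes to the sum.\<close>
  have "real (card E) * real N = (\<Sum>g\<in>E. real (ord g))" by (simp add: E_def)
  also have "\<dots> \<le> (\<Sum>g\<in>carrier G. real (ord g))"
    by (rule sum_mono2) (use fin in \<open>auto simp: E_def\<close>)
  finally have "real (card (carrier G)) * real (totient N) \<le> (\<Sum>g\<in>carrier G. real (ord g)) * real b"
    using count mult_right_mono[of "real (card E) * real N" _ "real b"] by fastforce
  then show ?thesis using b cG by (simp add: avg_order_def N_def field_simps)
qed

end

section \<open>The symplectic group\<close>

lemma finite_carrier_mat: "finite (carrier_mat r s :: 'a::finite mat set)"
proof -
  have "carrier_mat r s \<subseteq> (\<lambda>f. mat r s f) ` (({..<r} \<times> {..<s}) \<rightarrow>\<^sub>E (UNIV :: 'a set))"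
  proof
    fix A :: "'a mat" assume "A \<in> carrier_mat r s"
    then have dims: "dim_row A = r" "dim_col A = s" by auto
    define f where "f = restrict (\<lambda>ij. A $$ ij) ({..<r} \<times> {..<s})"
    have "A = mat r s f" by (rule eq_matI) (simp_all add: dims f_def)
    moreover have "f \<in> ({..<r} \<times> {..<s}) \<rightarrow>\<^sub>E UNIV" by (simp add: f_def)
    ultimately show "A \<in> (\<lambda>f. mat r s f) ` (({..<r} \<times> {..<s}) \<rightarrow>\<^sub>E UNIV)"
      by (rule image_eqI)
  qed
  then show ?thesis by (rule finite_subset) (intro finite_imageI finite_PiE, auto)
qed

lemma mult_mat_vec_unit_vec:
  fixes A :: "'a::semiring_1 mat"
  assumes "A \<in> carrier_mat m m" "j < m"
  shows "A *\<^sub>v unit_vec m j = col A j"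
  using assms by (intro eq_vecI) auto

lemma mat_eq_by_mult_mat_vec:
  fixes A :: "'a::semiring_1 mat"
  assumes "A \<in> carrier_mat m m" "C \<in> carrier_mat m m"
    and "\<And>x. x \<in> carrier_vec m \<Longrightarrow> A *\<^sub>v x = C *\<^sub>v x"
  shows "A = C"
  using assms by (intro mat_col_eqI) (auto simp flip: mult_mat_vec_unit_vec)

text \<open>The columns are the images of the unit vectors; agreement on \<open>x\<close> is proved
  on its truncations, adding one coordinate at a time.\<close>

lemma exists_matrix_of_linear:
  fixes f :: "'a::field vec \<Rightarrow> 'a vec"
  assumes closed: "\<And>x. x \<in> carrier_vec m \<Longrightarrow> f x \<in> carrier_vec m"
    and add: "\<And>x y. x \<in> carrier_vec m \<Longrightarrow> y \<in> carrier_vec m \<Longrightarrow> f (x + y) = f x + f y"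
    and homog: "\<And>c x. x \<in> carrier_vec m \<Longrightarrow> f (c \<cdot>\<^sub>v x) = c \<cdot>\<^sub>v f x"
  shows "\<exists>A\<in>carrier_mat m m. \<forall>x\<in>carrier_vec m. A *\<^sub>v x = f x"
proof -
  define A where "A = mat m m (\<lambda>(i, j). f (unit_vec m j) $ i)"
  have A: "A \<in> carrier_mat m m" by (simp add: A_def)
  have unit: "A *\<^sub>v unit_vec m j = f (unit_vec m j)" if "j < m" for j
    using closed[of "unit_vec m j"] that A
    by (subst mult_mat_vec_unit_vec) (auto simp: A_def)
  have "A *\<^sub>v x = f x" if x: "x \<in> carrier_vec m" for x
  proof -
    have "A *\<^sub>v vec m (\<lambda>i. if i < k then x $ i else 0) = f (vec m (\<lambda>i. if i < k then x $ i else 0))"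
      if "k \<le> m" for k
      using that
    proof (induction k)
      case 0
      have "vec m (\<lambda>i. if i < 0 then x $ i else 0) = 0 \<cdot>\<^sub>v x" using x by auto
      moreover have "A *\<^sub>v (0 \<cdot>\<^sub>v x) = 0\<^sub>v m" "f (0 \<cdot>\<^sub>v x) = 0\<^sub>v m"
        using A x closed[OF x] by (auto simp: mult_mat_vec[OF A x] homog[OF x])
      ultimately show ?case by simp
    next
      case (Suc k)
      have "vec m (\<lambda>i. if i < Suc k then x $ i else 0)
          = vec m (\<lambda>i. if i < k then x $ i else 0) + x $ k \<cdot>\<^sub>v unit_vec m k"
        using Suc.prems by (intro eq_vecI) (auto simp: less_Suc_eq)
      then show ?case
        using Suc A unit[of k]
        by (simp add: add homog mult_mat_vec mult_add_distrib_mat_vec[of _ m m])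
    qed
    from this[of m] show ?thesis
    proof -
      have "vec m (\<lambda>i. if i < m then x $ i else 0) = x" using x by auto
      then show ?thesis using \<open>m \<le> m \<Longrightarrow> _\<close> by simp
    qed
  qed
  then show ?thesis using A by blast
qed

section \<open>Transport of an arbitrary symplectic form to K\<close>

context torus
begin

definition coord_map :: "'a vec \<Rightarrow> 'a alg_closure" where
  "coord_map v = (\<Sum>i<2*n. to_ac (v $ i) * w ^ i)"

lemma coord_map_add:
  "x \<in> carrier_vec (2*n) \<Longrightarrow> y \<in> carrier_vec (2*n) \<Longrightarrow> coord_map (x + y) = coord_map x + coord_map y"
  by (simp add: coord_map_def distrib_right sum.distrib)

lemma coord_map_smult: "x \<in> carrier_vec (2*n) \<Longrightarrow> coord_map (a \<cdot>\<^sub>v x) = to_ac a * coord_map x"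
  by (simp add: coord_map_def sum_distrib_left mult.assoc)

lemma coord_map_K: "coord_map x \<in> K"
proof -
  have "(\<Sum>i<m. to_ac (x $ i) * w ^ i) \<in> K" for m
    by (induction m) (simp_all add: K_closed w_K)
  then show ?thesis by (simp add: coord_map_def)
qed

lemma bij_coord_map: "bij_betw coord_map (carrier_vec (2*n)) K"
proof (rule bij_betwI')
  fix x y :: "'a vec" assume xy: "x \<in> carrier_vec (2*n)" "y \<in> carrier_vec (2*n)"
  show "coord_map x = coord_map y \<longleftrightarrow> x = y"
  proof
    assume "coord_map x = coord_map y"
    then have "(\<Sum>i<2*n. to_ac (x $ i - y $ i) * w ^ i) = 0"
      by (simp add: coord_map_def left_diff_distrib sum_subtractf)
    from powers_independent[OF this] show "x = y" using xy by (intro eq_vecI) auto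
  qed simp
next
  fix z assume "z \<in> K"
  then obtain a :: "nat \<Rightarrow> 'a" where "z = (\<Sum>i<2*n. to_ac (a i) * w ^ i)" using powers_span by blast
  then have "z = coord_map (vec (2*n) a)" by (simp add: coord_map_def)
  then show "\<exists>x\<in>carrier_vec (2*n). z = coord_map x" by (intro bexI[of _ "vec (2*n) a"]) auto
qed (rule coord_map_K)

text \<open>The coordinate map in the basis of powers of \<open>w\<close> is linear but ignores
  \<open>B\<close>. Carrying \<open>B\<close> along it puts two symplectic forms on K, and an
  isometry between these corrects the coordinate map.\<close>

lemma exists_isometry:
  fixes B :: "'a vec \<Rightarrow> 'a vec \<Rightarrow> 'a"
  assumes alt: "alternating_form (2*n) B" and nd: "nondegenerate_form (2*n) B"
  obtains \<Phi> where "bij_betw \<Phi> (carrier_vec (2*n)) K"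
    "\<And>x y. x \<in> carrier_vec (2*n) \<Longrightarrow> y \<in> carrier_vec (2*n) \<Longrightarrow> \<Phi> (x + y) = \<Phi> x + \<Phi> y"
    "\<And>a x. x \<in> carrier_vec (2*n) \<Longrightarrow> \<Phi> (a \<cdot>\<^sub>v x) = to_ac a * \<Phi> x"
    "\<And>x y. x \<in> carrier_vec (2*n) \<Longrightarrow> y \<in> carrier_vec (2*n) \<Longrightarrow> form (\<Phi> x) (\<Phi> y) = B x y"
proof -
  let ?V = "carrier_vec (2*n) :: 'a vec set"
  define \<psi> where "\<psi> = inv_into ?V coord_map"
  define B1 where "B1 x y = B (\<psi> x) (\<psi> y)" for x y
  have \<psi>: "\<psi> x \<in> ?V" "coord_map (\<psi> x) = x" if "x \<in> K" for x
    using that bij_coord_map unfolding \<psi>_def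
    by (metis bij_betw_def inv_into_into, metis bij_betw_def f_inv_into_f)
  have \<psi>_inv: "\<psi> (coord_map v) = v" if "v \<in> ?V" for v
    using that bij_coord_map unfolding \<psi>_def by (simp add: bij_betw_def inv_into_f_f)
  have \<psi>_add: "\<psi> (x + y) = \<psi> x + \<psi> y" if "x \<in> K" "y \<in> K" for x y
    using \<psi>_inv[of "\<psi> x + \<psi> y"] \<psi> that by (simp add: coord_map_add)
  have \<psi>_scale: "\<psi> (to_ac a * x) = a \<cdot>\<^sub>v \<psi> x" if "x \<in> K" for a x
    using \<psi>_inv[of "a \<cdot>\<^sub>v \<psi> x"] \<psi> that by (simp add: coord_map_smult)
  have "symplectic_space (\<lambda>a x. to_ac (a :: 'a) * x) K B1 n"
  proof -
    interpret S: symplectic_space "\<lambda>a x. to_ac (a :: 'a) * x" K form n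
      by (rule symplectic_space_form)
    have bil: "bilinear_form (2*n) B" using alt by (simp add: alternating_form_def)
    show ?thesis
    proof (unfold_locales, goal_cases)
      case 1
      show ?case by (rule S.subspace_V)
    next
      case 2
      show ?case by (rule S.card_V)
    next
      case (3 x y z)
      then show ?case using bil \<psi> by (simp add: B1_def \<psi>_add bilinear_form_def)
    next
      case (4 x y z)
      then show ?case using bil \<psi> by (simp add: B1_def \<psi>_add bilinear_form_def)
    next
      case (5 a x y)
      then show ?case using bil \<psi> unfolding B1_def \<psi>_scale[OF 5(1)] bilinear_form_def by blast
    next
      case (6 a x y)
      then show ?case using bil \<psi> unfolding B1_def \<psi>_scale[OF 6(2)] bilinear_form_def by blast
    next
      case (7 x)
      then show ?case using alt \<psi> by (simp add: B1_def alternating_form_def)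
    next
      case (8 x)
      have "B (\<psi> x) y = 0" if "y \<in> ?V" for y
        using 8(2)[OF coord_map_K[of y]] \<psi>_inv[OF that] by (simp add: B1_def)
      then have "\<psi> x = 0\<^sub>v (2*n)" using nd \<psi>(1)[OF 8(1)] unfolding nondegenerate_form_def by blast
      then have "x = coord_map (0\<^sub>v (2*n))" using \<psi>(2)[OF 8(1)] by simp
      then show ?case by (simp add: coord_map_def)
    qed
  qed
  from symplectic_isometry[OF symplectic_space_form this]
  obtain \<gamma> where \<gamma>: "bij_betw \<gamma> K K"
    "\<And>x y. x \<in> K \<Longrightarrow> y \<in> K \<Longrightarrow> \<gamma> (x + y) = \<gamma> x + \<gamma> y"
    "\<And>a x. x \<in> K \<Longrightarrow> \<gamma> (to_ac (a :: 'a) * x) = to_ac a * \<gamma> x"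
    "\<And>x y. x \<in> K \<Longrightarrow> y \<in> K \<Longrightarrow> form (\<gamma> x) (\<gamma> y) = B1 x y"
    by metis
  show ?thesis
    by (rule that[of "\<gamma> \<circ> coord_map"])
      (use \<gamma> bij_coord_map \<psi>_inv in \<open>auto intro: bij_betw_trans
        simp: coord_map_add coord_map_smult coord_map_K B1_def\<close>)
qed

end

lemma carrier_Sp:
  "A \<in> carrier (Sp m B) \<longleftrightarrow> A \<in> carrier (GL m) \<and>
     (\<forall>x\<in>carrier_vec m. \<forall>y\<in>carrier_vec m. B (A *\<^sub>v x) (A *\<^sub>v y) = B x y)"
  by (simp add: Sp_def)

lemma mult_Sp [simp]: "A \<otimes>\<^bsub>Sp m B\<^esub> C = A * C"
  by (simp add: Sp_def)

lemma one_Sp [simp]: "\<one>\<^bsub>Sp m B\<^esub> = 1\<^sub>m m"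
  by (simp add: Sp_def)

lemma carrier_Sp_carrier_mat: "A \<in> carrier (Sp m B) \<Longrightarrow> A \<in> carrier_mat m m"
  by (simp add: carrier_Sp carrier_GL)

lemma finite_carrier_Sp: "finite (carrier (Sp m (B :: 'a::{field,finite} vec \<Rightarrow> _)))"
  by (rule finite_subset[OF _ finite_carrier_mat[of m m]]) (use carrier_Sp_carrier_mat in blast)

section \<open>The average order of the symplectic group\<close>

context torus
begin

text \<open>Multiplication by \<open>w\<close> becomes a symplectic matrix \<open>M\<close> of order
  \<open>q^n + 1\<close>. Read on K, the matrices normalising its cyclic group fall under
  \<open>card_normalizer_le\<close>, so the counting bound applies with
  \<open>b = 2 * n\<close>.\<close>

lemma avg_order_Sp_ge:
  fixes B :: "'a vec \<Rightarrow> 'a vec \<Rightarrow> 'a"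
  assumes alt: "alternating_form (2*n) B" and nd: "nondegenerate_form (2*n) B"
  shows "avg_order (Sp (2*n) B) \<ge> real (totient (q^n + 1)) / real (2 * n)"
proof -
  let ?V = "carrier_vec (2*n) :: 'a vec set"
  let ?G = "Sp (2*n) B"
  interpret G: group ?G by (rule group_Sp)
  obtain \<Phi> where bij: "bij_betw \<Phi> ?V K"
    and add: "\<And>x y. x \<in> ?V \<Longrightarrow> y \<in> ?V \<Longrightarrow> \<Phi> (x + y) = \<Phi> x + \<Phi> y"
    and homog: "\<And>a x. x \<in> ?V \<Longrightarrow> \<Phi> (a \<cdot>\<^sub>v x) = to_ac a * \<Phi> x"
    and iso: "\<And>x y. x \<in> ?V \<Longrightarrow> y \<in> ?V \<Longrightarrow> form (\<Phi> x) (\<Phi> y) = B x y"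
    using exists_isometry[OF alt nd] by metis
  define \<Psi> where "\<Psi> = inv_into ?V \<Phi>"
  have \<Psi>: "\<Psi> x \<in> ?V" "\<Phi> (\<Psi> x) = x" if "x \<in> K" for x
    using that bij_betwE[OF bij_betw_inv_into[OF bij]] bij_betw_inv_into_right[OF bij]
    by (auto simp: \<Psi>_def)
  have \<Phi>_K: "\<Phi> v \<in> K" if "v \<in> ?V" for v using bij_betwE[OF bij] that by blast
  have \<Psi>_\<Phi>: "\<Psi> (\<Phi> v) = v" if "v \<in> ?V" for v
    using bij_betw_inv_into_left[OF bij that] by (simp add: \<Psi>_def)
  have \<Psi>_add: "\<Psi> (x + y) = \<Psi> x + \<Psi> y" if "x \<in> K" "y \<in> K" for x y
    using \<Psi>_\<Phi>[of "\<Psi> x + \<Psi> y"] \<Psi> that by (simp add: add)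
  have \<Psi>_scale: "\<Psi> (to_ac a * x) = a \<cdot>\<^sub>v \<Psi> x" if "x \<in> K" for a x
    using \<Psi>_\<Phi>[of "a \<cdot>\<^sub>v \<Psi> x"] \<Psi> that by (simp add: homog)
  have mult_matrix: "\<exists>A\<in>carrier_mat (2*n) (2*n). \<forall>v\<in>?V. A *\<^sub>v v = \<Psi> (z * \<Phi> v)" if z: "z \<in> K" for z
  proof (rule exists_matrix_of_linear)
    fix x y :: "'a vec" and a assume x: "x \<in> ?V" and y: "y \<in> ?V"
    show "\<Psi> (z * \<Phi> x) \<in> ?V" using \<Psi> \<Phi>_K x z by (simp add: K_closed)
    show "\<Psi> (z * \<Phi> (x + y)) = \<Psi> (z * \<Phi> x) + \<Psi> (z * \<Phi> y)"
      using \<Phi>_K x y z by (simp add: add distrib_left \<Psi>_add K_closed)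
    show "\<Psi> (z * \<Phi> (a \<cdot>\<^sub>v x)) = a \<cdot>\<^sub>v \<Psi> (z * \<Phi> x)"
      using \<Phi>_K x z \<Psi>_scale[of "z * \<Phi> x" a] by (simp add: homog K_closed mult.left_commute)
  qed
  obtain M where M: "M \<in> carrier_mat (2*n) (2*n)" "\<And>v. v \<in> ?V \<Longrightarrow> M *\<^sub>v v = \<Psi> (w * \<Phi> v)"
    using mult_matrix[OF w_K] by blast
  \<comment> \<open>Multiplication by the inverse of \<open>w\<close> supplies the inverse matrix
    required for membership in \<open>GL\<close>.\<close>
  obtain M' where M': "M' \<in> carrier_mat (2*n) (2*n)" "\<And>v. v \<in> ?V \<Longrightarrow> M' *\<^sub>v v = \<Psi> (inverse w * \<Phi> v)"
    using mult_matrix[OF K_closed(7)[OF w_K]] by blast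
  have \<Phi>_M: "\<Phi> (M *\<^sub>v v) = w * \<Phi> v" if "v \<in> ?V" for v
    using that \<Phi>_K w_K by (simp add: M(2) \<Psi> K_closed)
  have \<Phi>_M': "\<Phi> (M' *\<^sub>v v) = inverse w * \<Phi> v" if "v \<in> ?V" for v
    using that \<Phi>_K w_K by (simp add: M'(2) \<Psi> K_closed)
  have "M' * M = 1\<^sub>m (2*n)"
  proof (rule mat_eq_by_mult_mat_vec)
    fix v assume v: "v \<in> ?V"
    have "\<Phi> (M' *\<^sub>v (M *\<^sub>v v)) = \<Phi> v"
      using v M(1) w_nz \<Phi>_M'[of "M *\<^sub>v v"] by (simp add: \<Phi>_M)
    then show "(M' * M) *\<^sub>v v = 1\<^sub>m (2*n) *\<^sub>v v"
      using v M(1) M'(1) \<Psi>_\<Phi>[of "M' *\<^sub>v (M *\<^sub>v v)"] by (simp add: \<Psi>_\<Phi>)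
  qed (use M(1) M'(1) in auto)
  moreover have "M * M' = 1\<^sub>m (2*n)"
  proof (rule mat_eq_by_mult_mat_vec)
    fix v assume v: "v \<in> ?V"
    have "\<Phi> (M *\<^sub>v (M' *\<^sub>v v)) = \<Phi> v"
      using v M'(1) w_nz \<Phi>_M[of "M' *\<^sub>v v"] by (simp add: \<Phi>_M')
    then show "(M * M') *\<^sub>v v = 1\<^sub>m (2*n) *\<^sub>v v"
      using v M(1) M'(1) \<Psi>_\<Phi>[of "M *\<^sub>v (M' *\<^sub>v v)"] by (simp add: \<Psi>_\<Phi>)
  qed (use M(1) M'(1) in auto)
  moreover have "B (M *\<^sub>v x) (M *\<^sub>v y) = B x y" if "x \<in> ?V" "y \<in> ?V" for x y
  proof -
    have "B (M *\<^sub>v x) (M *\<^sub>v y) = form (\<Phi> (M *\<^sub>v x)) (\<Phi> (M *\<^sub>v y))"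
      using that M(1) by (simp add: iso)
    also have "\<dots> = B x y" using that \<Phi>_K by (simp add: \<Phi>_M form_w iso)
    finally show ?thesis .
  qed
  ultimately have M_Sp: "M \<in> carrier ?G" using M(1) M'(1) by (auto simp: carrier_Sp carrier_GL)
  have Mpow: "M [^]\<^bsub>?G\<^esub> j \<in> carrier_mat (2*n) (2*n)" for j :: nat
    by (rule carrier_Sp_carrier_mat[OF G.nat_pow_closed[OF M_Sp]])
  have \<Phi>_Mpow: "\<Phi> (M [^]\<^bsub>?G\<^esub> j *\<^sub>v v) = w ^ j * \<Phi> v" if "v \<in> ?V" for j :: nat and v
    using that
  proof (induction j arbitrary: v)
    case (Suc j)
    have "M [^]\<^bsub>?G\<^esub> Suc j *\<^sub>v v = M [^]\<^bsub>?G\<^esub> j *\<^sub>v (M *\<^sub>v v)"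
      using Mpow[of j] M(1) Suc.prems by (simp add: assoc_mult_mat_vec[of _ "2*n" "2*n" _ "2*n"])
    then show ?case using Suc.IH[of "M *\<^sub>v v"] Suc.prems M(1) by (simp add: \<Phi>_M)
  qed simp
  have "M [^]\<^bsub>?G\<^esub> i = \<one>\<^bsub>?G\<^esub> \<longleftrightarrow> (q^n + 1) dvd i" for i :: nat
  proof
    assume "M [^]\<^bsub>?G\<^esub> i = \<one>\<^bsub>?G\<^esub>"
    then have "w ^ i = 1" using \<Phi>_Mpow[OF \<Psi>(1)[OF K_closed(2)], of i] \<Psi> K_closed(2) by simp
    then show "(q^n + 1) dvd i" by (rule w_order)
  next
    assume "(q^n + 1) dvd i"
    then obtain k where "i = (q^n + 1) * k" ..
    then have "w ^ i = 1" by (simp only: power_mult w_root power_one)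
    then have "M [^]\<^bsub>?G\<^esub> i *\<^sub>v v = 1\<^sub>m (2*n) *\<^sub>v v" if "v \<in> ?V" for v
      using \<Phi>_Mpow[OF that, of i] \<Psi>_\<Phi>[OF that] \<Psi>_\<Phi>[of "M [^]\<^bsub>?G\<^esub> i *\<^sub>v v"] Mpow[of i] that by simp
    then show "M [^]\<^bsub>?G\<^esub> i = \<one>\<^bsub>?G\<^esub>"
      using mat_eq_by_mult_mat_vec[OF Mpow one_carrier_mat] by simp
  qed
  then have ord_M: "G.ord M = q^n + 1" using G.ord_unique[OF M_Sp] by blast
  define W where "W = {h \<in> carrier ?G. \<exists>j::nat. h * M = M [^]\<^bsub>?G\<^esub> j * h}"
  define H where "H h x = \<Phi> (h *\<^sub>v \<Psi> x)" for h x
  have WD: "h \<in> carrier ?G" "h \<in> carrier_mat (2*n) (2*n)" if "h \<in> W" for h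
    using that carrier_Sp_carrier_mat by (auto simp: W_def)
  have "card W \<le> 2 * n * (q^n + 1)"
  proof (rule card_normalizer_le[where H = H])
    fix h assume hW: "h \<in> W"
    note h = WD[OF hW]
    obtain C where C: "C \<in> carrier_mat (2*n) (2*n)" "C * h = 1\<^sub>m (2*n)" "h * C = 1\<^sub>m (2*n)"
      using h(1) by (auto simp: carrier_Sp carrier_GL)
    have "bij_betw (\<lambda>v. h *\<^sub>v v) ?V ?V"
    proof (rule bij_betwI[of _ _ _ "\<lambda>v. C *\<^sub>v v"])
      fix v assume v: "v \<in> ?V"
      show "C *\<^sub>v (h *\<^sub>v v) = v" using assoc_mult_mat_vec[OF C(1) h(2) v] C(2) v by simp
      show "h *\<^sub>v (C *\<^sub>v v) = v" using assoc_mult_mat_vec[OF h(2) C(1) v] C(3) v by simp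
    qed (use h C in auto)
    then have "bij_betw (\<Phi> \<circ> ((\<lambda>v. h *\<^sub>v v) \<circ> \<Psi>)) K K"
      using bij bij_betw_inv_into[OF bij] unfolding \<Psi>_def by (blast intro: bij_betw_trans)
    then have "bij_betw (H h) K K" by (simp add: H_def[abs_def] o_def)
    moreover have "H h (x + y) = H h x + H h y" if "x \<in> K" "y \<in> K" for x y
      using that \<Psi> h(2) by (simp add: H_def \<Psi>_add mult_add_distrib_mat_vec[of _ "2*n" "2*n"] add)
    moreover have "form (H h x) (H h y) = form x y" if "x \<in> K" "y \<in> K" for x y
    proof -
      have "form (H h x) (H h y) = B (h *\<^sub>v \<Psi> x) (h *\<^sub>v \<Psi> y)"
        using that \<Psi> h(2) by (simp add: H_def iso)
      also have "\<dots> = B (\<Psi> x) (\<Psi> y)" using h(1) \<Psi> that by (simp add: carrier_Sp)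
      finally show ?thesis using \<Psi> that by (simp flip: iso)
    qed
    moreover have "H h (to_ac a * x) = to_ac a * H h x" if "x \<in> K" for a x
      using that \<Psi> h(2) by (simp add: H_def \<Psi>_scale mult_mat_vec homog)
    ultimately show "linear_isometry (H h)" by (simp add: linear_isometry_def)
    obtain j :: nat where j: "h * M = M [^]\<^bsub>?G\<^esub> j * h" using hW by (auto simp: W_def)
    have "H h (w * x) = w ^ j * H h x" if x: "x \<in> K" for x
    proof -
      have "\<Psi> (w * x) = M *\<^sub>v \<Psi> x" using M(2)[OF \<Psi>(1)[OF x]] \<Psi>(2)[OF x] by simp
      then have "h *\<^sub>v \<Psi> (w * x) = M [^]\<^bsub>?G\<^esub> j *\<^sub>v (h *\<^sub>v \<Psi> x)"
        using assoc_mult_mat_vec[OF h(2) M(1) \<Psi>(1)[OF x]]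
          assoc_mult_mat_vec[OF Mpow h(2) \<Psi>(1)[OF x]] j by simp
      then show ?thesis using \<Phi>_Mpow \<Psi>(1)[OF x] h(2) by (simp add: H_def)
    qed
    then show "\<exists>z. \<forall>x\<in>K. H h (w * x) = z * H h x" by blast
  next
    fix h h' assume h: "h \<in> W" "h' \<in> W" and eq: "\<And>x. x \<in> K \<Longrightarrow> H h x = H h' x"
    show "h = h'"
    proof (rule mat_eq_by_mult_mat_vec[OF WD(2)[OF h(1)] WD(2)[OF h(2)]])
      fix v assume v: "v \<in> ?V"
      have "\<Phi> (h *\<^sub>v v) = \<Phi> (h' *\<^sub>v v)" using eq[OF \<Phi>_K[OF v]] \<Psi>_\<Phi>[OF v] by (simp add: H_def)
      then show "h *\<^sub>v v = h' *\<^sub>v v"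
        by (rule inj_onD[OF bij_betw_imp_inj_on[OF bij]])
          (rule mult_mat_vec_carrier[OF WD(2)[OF h(1)] v] mult_mat_vec_carrier[OF WD(2)[OF h(2)] v])+
    qed
  qed
  then show ?thesis
    using G.avg_order_ge_totient[OF finite_carrier_Sp M_Sp, of "2*n"] n_pos
    by (simp add: W_def ord_M)
qed

end

theorem theorem26:
  fixes p k q :: nat
  assumes "prime p" and "odd p" and "k \<ge> 1" and "q = p ^ k"
    and "card (UNIV :: 'a::{field,finite} set) = q"
  shows "\<exists>r :: nat \<Rightarrow> real. r \<in> o(\<lambda>n. ln (real n)) \<and>
    (\<forall>n\<ge>1. \<forall>B :: 'a vec \<Rightarrow> 'a vec \<Rightarrow> 'a.
       alternating_form (2 * n) B \<longrightarrow> nondegenerate_form (2 * n) B \<longrightarrow>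
       ln (avg_order (Sp (2 * n) B)) \<ge> real n * ln (real q) - ln (real n) + r n)"
proof (intro exI conjI allI impI)
  have "CHAR('a) dvd p ^ k"
    using CHAR_dvd_CARD[where 'a = 'a] assms(4,5) by simp
  moreover have prime_char: "prime CHAR('a)"
    using finite_imp_CHAR_pos[where ?'a = 'a] prime_CHAR_semidom[where ?'a = 'a] by simp
  ultimately have char: "CHAR('a) = p"
    using assms(1) prime_dvd_power primes_dvd_imp_eq by blast
  have q2: "q \<ge> 2"
    using card_mono[of "UNIV :: 'a set" "{0, 1}"] assms(5) by simp
  \<comment> \<open>This depends on \<open>q\<close> and \<open>n\<close> only, so one error term
    serves every form \<open>B\<close>; with it the claimed bound is exactly the logarithm of
    \<open>totient (q^n + 1) / (2 * n)\<close>.\<close>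
  let ?r = "\<lambda>n. ln (real (totient (q^n + 1))) - real n * ln (real q) - ln 2"
  show "?r \<in> o(\<lambda>n. ln (real n))" by (rule ln_totient_power_Suc_asymp[OF q2])
  fix n :: nat and B :: "'a vec \<Rightarrow> 'a vec \<Rightarrow> 'a"
  assume n: "n \<ge> 1" and B: "alternating_form (2 * n) B" "nondegenerate_form (2 * n) B"
  interpret finite_field_tower "TYPE('a)" q n k
    by unfold_locales (use n assms char in auto)
  obtain w where w: "w \<in> K" "w ^ (q^n + 1) = 1" "\<And>i. w ^ i = 1 \<Longrightarrow> (q^n + 1) dvd i"
    using exists_primitive_root by blast
  obtain c :: "'a alg_closure" where c: "c \<noteq> 0" "c ^ (q^n) = - c" using exists_skew_element by blast
  interpret torus "TYPE('a)" q n k w c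
    by unfold_locales (use w c in blast)+
  have pos: "real (totient (q^n + 1)) > 0" by simp
  have "?r n + real n * ln (real q) - ln (real n) = ln (real (totient (q^n + 1)) / real (2 * n))"
    using n pos by (subst ln_div) (auto simp: ln_mult)
  also have "\<dots> \<le> ln (avg_order (Sp (2 * n) B))"
    using avg_order_Sp_ge[OF B] pos n by (intro ln_mono) (auto intro: divide_pos_pos)
  finally show "ln (avg_order (Sp (2 * n) B)) \<ge> real n * ln (real q) - ln (real n) + ?r n"
    by simp
qed

end
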